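(* Let $\Gamma$ be a bridgeless metrized graph with edges $e_1,\dots,e_e$, where $e_i$ has length $L_i$ and end points $p_i,q_i$. Then $$\tau(\Gamma)=\frac{\ell(\Gamma)}{12}-\sum_{i=1}^{e}\frac{L_i\,A_{p_i,q_i,\Gamma-e_i}}{(L_i+R_i)^2}.$$
   Context: A metrized graph is a finite connected graph (multiple edges and self-loops allowed) in which each edge is identified with a closed interval of positive length; $\ell(\Gamma)$ is total length. It is bridgeless if $\Gamma-e_i$ ($\Gamma$ with the interior of $e_i$ removed) is connected for every edge $e_i$. Regard graphs as resistive circuits with segment resistance equal to length; $r(x,y)$ is effective resistance; $R_i$ is the effective resistance between $p_i,q_i$ in $\Gamma-e_i$; $j_z(x,y)$ is the potential at $x$ when unit current enters at $y$ and exits at $z$, with potential $0$ at $z$. For a metrized graph $G$ and $p,q\in G$, $A_{p,q,G}=\int_G j_x(p,q)\big(\frac{d}{dx}j_p(x,q)\big)^2dx$ (voltage function of $G$, $dx$ arclength). The tau constant is $\tau(G)=\frac14\int_G\big(\frac{\partial}{\partial x}r(x,y)\big)^2dx$ (independent of $y$). *)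

theory Defs
  imports "HOL-Analysis.Analysis" "Graph_Theory.Graph_Theory"
begin

text \<open>
  The underlying finite multigraph (loops and parallel edges allowed) is a digraph of the
  Graph-Theory library. The direction of an arc carries no meaning beyond fixing the arclength
  parametrisation of the edge by [0, L e], from the tail (p) at 0 to the head (q) at L e.
  Connectedness is that of the underlying undirected graph.
\<close>

locale metrized_graph = fin_digraph G
  for G :: "('v, 'e) pre_digraph" +
  fixes L :: "'e \<Rightarrow> real"
  assumes connected: "Digraph_Component.connected G"
    and length_pos: "e \<in> arcs G \<Longrightarrow> 0 < L e"

definition bridgeless :: "('v, 'e) pre_digraph \<Rightarrow> bool" where
  "bridgeless G \<longleftrightarrow> (\<forall>e \<in> arcs G. Digraph_Component.connected (pre_digraph.del_arc G e))"

definition total_length :: "('v, 'e) pre_digraph \<Rightarrow> ('e \<Rightarrow> real) \<Rightarrow> real" where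
  "total_length G L = (\<Sum>e \<in> arcs G. L e)"

text \<open>
  A point is a vertex or lies in the interior of exactly one edge, so every point has exactly one
  representation and equality of points is equality in the datatype.
\<close>

datatype ('v, 'e) point = Vertex 'v | Interior 'e real

definition points :: "('v, 'e) pre_digraph \<Rightarrow> ('e \<Rightarrow> real) \<Rightarrow> ('v, 'e) point set" where
  "points G L = Vertex ` verts G \<union> {Interior e t | e t. e \<in> arcs G \<and> 0 < t \<and> t < L e}"

definition edge_point ::
    "('v, 'e) pre_digraph \<Rightarrow> ('e \<Rightarrow> real) \<Rightarrow> 'e \<Rightarrow> real \<Rightarrow> ('v, 'e) point" where
  "edge_point G L e t =
     (if t \<le> 0 then Vertex (tail G e) else if L e \<le> t then Vertex (head G e) else Interior e t)"

text \<open>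
  Sum of the slopes of \<open>f\<close> at a point over all directions leaving that point; a loop leaves
  its base vertex in two directions.
\<close>

primrec slope_sum ::
    "('v, 'e) pre_digraph \<Rightarrow> ('e \<Rightarrow> real) \<Rightarrow> (('v, 'e) point \<Rightarrow> real) \<Rightarrow> ('v, 'e) point \<Rightarrow> real" where
  "slope_sum G L f (Vertex v) =
     (\<Sum>e \<in> out_arcs G v. vector_derivative (\<lambda>t. f (edge_point G L e t)) (at_right 0))
     - (\<Sum>e \<in> in_arcs G v. vector_derivative (\<lambda>t. f (edge_point G L e t)) (at_left (L e)))"
| "slope_sum G L f (Interior e s) =
     vector_derivative (\<lambda>t. f (edge_point G L e t)) (at_right s)
     - vector_derivative (\<lambda>t. f (edge_point G L e t)) (at_left s)"

text \<open>
  \<open>f\<close> is the potential, grounded at \<open>z\<close>, when unit current enters at \<open>y\<close> and exits at \<open>z\<close>: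
  by Ohm's law it is affine in arclength on every closed segment of an edge whose interior avoids
  \<open>y\<close> and \<open>z\<close> (so the current there, minus the slope, is constant); by Kirchhoff's law the current
  flowing away from a point equals the current injected there.
\<close>

definition unit_current_potential ::
    "('v, 'e) pre_digraph \<Rightarrow> ('e \<Rightarrow> real) \<Rightarrow> ('v, 'e) point \<Rightarrow> ('v, 'e) point \<Rightarrow>
     (('v, 'e) point \<Rightarrow> real) \<Rightarrow> bool" where
  "unit_current_potential G L y z f \<longleftrightarrow>
     f z = 0 \<and>
     (\<forall>e \<in> arcs G. \<forall>a b. 0 \<le> a \<longrightarrow> a \<le> b \<longrightarrow> b \<le> L e \<longrightarrow>
        (\<forall>t \<in> {a<..<b}. edge_point G L e t \<noteq> y \<and> edge_point G L e t \<noteq> z) \<longrightarrow>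
        (\<exists>c. \<forall>t \<in> {a..b}. f (edge_point G L e t) = f (edge_point G L e a) + c * (t - a))) \<and>
     (\<forall>x \<in> points G L. - slope_sum G L f x = of_bool (x = y) - of_bool (x = z))"

text \<open>
  \<open>voltage G L z x y\<close> is \<open>j\<^sub>z(x, y)\<close>. The description ranges over the value at \<open>x\<close>, since
  potentials are only determined on the points of the graph.
\<close>

definition voltage ::
    "('v, 'e) pre_digraph \<Rightarrow> ('e \<Rightarrow> real) \<Rightarrow> ('v, 'e) point \<Rightarrow> ('v, 'e) point \<Rightarrow> ('v, 'e) point \<Rightarrow> real"
  where
  "voltage G L z x y = (THE u. \<exists>f. unit_current_potential G L y z f \<and> f x = u)"

definition eff_resistance ::
    "('v, 'e) pre_digraph \<Rightarrow> ('e \<Rightarrow> real) \<Rightarrow> ('v, 'e) point \<Rightarrow> ('v, 'e) point \<Rightarrow> real" where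
  "eff_resistance G L x y = voltage G L y x x"

definition graph_integral ::
    "('v, 'e) pre_digraph \<Rightarrow> ('e \<Rightarrow> real) \<Rightarrow> (('v, 'e) point \<Rightarrow> real) \<Rightarrow> real" where
  "graph_integral G L F = (\<Sum>e \<in> arcs G. integral {0..L e} (\<lambda>t. F (edge_point G L e t)))"

text \<open>
  Arclength derivative. Its sign depends on the direction of the arc, but it is only used squared;
  the value at the finitely many vertices is irrelevant for integrals.
\<close>

primrec arc_deriv ::
    "('v, 'e) pre_digraph \<Rightarrow> ('e \<Rightarrow> real) \<Rightarrow> (('v, 'e) point \<Rightarrow> real) \<Rightarrow> ('v, 'e) point \<Rightarrow> real" where
  "arc_deriv G L F (Vertex v) = 0"
| "arc_deriv G L F (Interior e s) = deriv (\<lambda>t. F (edge_point G L e t)) s"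

definition A_const ::
    "('v, 'e) pre_digraph \<Rightarrow> ('e \<Rightarrow> real) \<Rightarrow> ('v, 'e) point \<Rightarrow> ('v, 'e) point \<Rightarrow> real" where
  "A_const G L p q =
     graph_integral G L (\<lambda>x. voltage G L x p q * (arc_deriv G L (\<lambda>w. voltage G L p w q) x)\<^sup>2)"

text \<open>
  The tau constant computed with base point \<open>y\<close>; it does not depend on the choice of \<open>y\<close>.
\<close>

definition tau ::
    "('v, 'e) pre_digraph \<Rightarrow> ('e \<Rightarrow> real) \<Rightarrow> ('v, 'e) point \<Rightarrow> real" where
  "tau G L y = 1/4 * graph_integral G L (\<lambda>x. (arc_deriv G L (\<lambda>w. eff_resistance G L w y) x)\<^sup>2)"

end

theory Submission
  imports Defs
begin

text \<open>
  Fix a grounded vertex and let \<open>g\<close> be the Green function of the weighted graph Laplacian, so that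
  \<open>g(u, v)\<close> is the voltage at \<open>u\<close> when unit current enters at \<open>v\<close> and leaves at the ground.
  Interpolating \<open>g\<close> bilinearly along the edges and adding, on each edge, the Green function of an
  interval with grounded ends gives a kernel \<open>K\<close> on all points of the graph for which
  \<open>j\<^sub>z(x, y) = K(x, y) - K(x, z) - K(z, y) + K(z, z)\<close>. All integrals are then integrals of explicit
  polynomials. With \<open>\<rho>\<^sub>e\<close> the effective resistance between the ends of \<open>e\<close> and \<open>\<gamma>(v) = g(v, v)\<close>,
  the tau constant satisfies \<open>4 \<tau> = E(\<gamma>, \<gamma>) + \<Sum> L\<^sub>e (1 - \<rho>\<^sub>e / L\<^sub>e)\<^sup>2 / 3\<close>, where \<open>E\<close> is the Dirichlet
  form. Deleting \<open>e\<close> is a rank-one perturbation of \<open>E\<close>, which expresses the summand of \<open>e\<close> through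
  the Green function of the whole graph. What remains is an identity between finite sums; it follows
  by testing Kirchhoff's law for the current from one end of \<open>e\<close> to the other against suitable
  polynomials in the potentials, and from the symmetry in \<open>e\<close> and \<open>k\<close> of the drop along \<open>k\<close> caused
  by a unit current between the ends of \<open>e\<close>.
\<close>

section \<open>The Dirichlet form and its Green function\<close>

text \<open>Gaussian elimination, by induction on the index set: positive definiteness makes the
  pivot \<open>a s s\<close> positive, and the Schur complement is again symmetric and positive
  definite. It will be applied to the Laplacian with the ground removed.\<close>

lemma positive_definite_solvable:
  fixes a :: "'a \<Rightarrow> 'a \<Rightarrow> real"
  assumes "finite S"
    and "\<And>v w. v \<in> S \<Longrightarrow> w \<in> S \<Longrightarrow> a v w = a w v"
    and "\<And>f. (\<Sum>v\<in>S. \<Sum>w\<in>S. f v * a v w * f w) \<le> 0 \<Longrightarrow> \<forall>v\<in>S. f v = 0"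
  shows "\<exists>f. \<forall>v\<in>S. (\<Sum>w\<in>S. a v w * f w) = b v"
  using assms
proof (induction S arbitrary: a b rule: finite_induct)
  case empty
  then show ?case by simp
next
  case (insert s S)
  have sym: "a s v = a v s" if "v \<in> S" for v
    using insert.prems(1) that by blast
  have sums: "(\<Sum>v\<in>insert s S. \<Sum>w\<in>insert s S. f v * a v w * f w)
      = (f s)\<^sup>2 * a s s + 2 * f s * (\<Sum>w\<in>S. a s w * f w) + (\<Sum>v\<in>S. \<Sum>w\<in>S. f v * a v w * f w)"
    for f
  proof -
    have "(\<Sum>v\<in>S. f v * a v s * f s) = f s * (\<Sum>w\<in>S. a s w * f w)"
      by (simp add: sum_distrib_left sym mult_ac)
    moreover have "(\<Sum>w\<in>S. f s * a s w * f w) = f s * (\<Sum>w\<in>S. a s w * f w)"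
      by (simp add: sum_distrib_left mult_ac)
    ultimately show ?thesis
      using insert.hyps by (simp add: sum.distrib power2_eq_square algebra_simps)
  qed
  \<comment> \<open>Otherwise the indicator of \<open>s\<close> would be a nonzero vector with form
    value at most zero.\<close>
  have pos: "a s s > 0"
  proof (rule ccontr)
    assume "\<not> a s s > 0"
    moreover have "(\<Sum>v\<in>insert s S. \<Sum>w\<in>insert s S. of_bool (v = s) * a v w * of_bool (w = s)) = a s s"
      unfolding sums using insert.hyps by (auto intro!: sum.neutral)
    ultimately show False
      using insert.prems(2)[of "\<lambda>v. of_bool (v = s)"] by auto
  qed
  \<comment> \<open>The Schur complement of the pivot: the system left after eliminating the unknown
    at \<open>s\<close>.\<close>
  define a' where "a' v w = a v w - a s v * a s w / a s s" for v w
  have quad: "(\<Sum>v\<in>S. \<Sum>w\<in>S. f v * a' v w * f w)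
      = (\<Sum>v\<in>S. \<Sum>w\<in>S. f v * a v w * f w) - (\<Sum>w\<in>S. a s w * f w)\<^sup>2 / a s s" for f
  proof -
    have "(\<Sum>w\<in>S. a s w * f w)\<^sup>2 / a s s = (\<Sum>v\<in>S. \<Sum>w\<in>S. f v * (a s v * a s w / a s s) * f w)"
      by (simp add: power2_eq_square sum_product sum_divide_distrib mult_ac)
    then show ?thesis
      by (simp add: a'_def sum_subtractf algebra_simps)
  qed
  have "\<exists>f. \<forall>v\<in>S. (\<Sum>w\<in>S. a' v w * f w) = b v - a s v * b s / a s s"
  proof (rule insert.IH)
    show "a' v w = a' w v" if "v \<in> S" "w \<in> S" for v w
      using that insert.prems(1) by (simp add: a'_def)
    fix f assume le: "(\<Sum>v\<in>S. \<Sum>w\<in>S. f v * a' v w * f w) \<le> 0"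
    define c where "c = (\<Sum>w\<in>S. a s w * f w)"
    \<comment> \<open>For fixed values on \<open>S\<close>, this value at \<open>s\<close> minimises
      the form of \<open>a\<close>; the minimum is the form of \<open>a'\<close> at
      \<open>f\<close>.\<close>
    define F where "F = f(s := - c / a s s)"
    have F: "F v = f v" if "v \<in> S" for v
      using that insert.hyps by (auto simp: F_def)
    have eqs: "(\<Sum>w\<in>S. a s w * F w) = c" "F s = - c / a s s"
      "(\<Sum>v\<in>S. \<Sum>w\<in>S. F v * a v w * F w) = (\<Sum>v\<in>S. \<Sum>w\<in>S. f v * a v w * f w)"
      using F by (auto simp: c_def F_def[THEN fun_cong, of s] intro!: sum.cong)
    have "(\<Sum>v\<in>insert s S. \<Sum>w\<in>insert s S. F v * a v w * F w)
        = (\<Sum>v\<in>S. \<Sum>w\<in>S. f v * a v w * f w) - c\<^sup>2 / a s s"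
      unfolding sums eqs using pos by (simp add: field_simps power2_eq_square)
    also have "\<dots> \<le> 0"
      using le unfolding quad c_def .
    finally have "\<forall>v\<in>insert s S. F v = 0"
      by (rule insert.prems(2))
    then show "\<forall>v\<in>S. f v = 0"
      using F by auto
  qed
  then obtain f where f: "\<And>v. v \<in> S \<Longrightarrow> (\<Sum>w\<in>S. a' v w * f w) = b v - a s v * b s / a s s"
    by blast
  define c where "c = (\<Sum>w\<in>S. a s w * f w)"
  \<comment> \<open>Back substitution: the equation of row \<open>s\<close> is solved for the value
    at \<open>s\<close>.\<close>
  define F where "F = f(s := (b s - c) / a s s)"
  have Fs: "F s = (b s - c) / a s s"
    by (simp add: F_def)
  have F: "(\<Sum>w\<in>insert s S. a v w * F w) = a v s * F s + (\<Sum>w\<in>S. a v w * f w)" for v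
    using insert.hyps by (auto simp: F_def intro!: sum.cong)
  have "(\<Sum>w\<in>insert s S. a v w * F w) = b v" if "v \<in> insert s S" for v
  proof (cases "v = s")
    case True
    then show ?thesis
      unfolding F Fs using pos by (simp add: c_def)
  next
    case False
    then have v: "v \<in> S" using that by simp
    have "(\<Sum>w\<in>S. a' v w * f w) = (\<Sum>w\<in>S. a v w * f w) - a s v * c / a s s"
      by (simp add: a'_def c_def sum_distrib_left sum_divide_distrib sum_subtractf algebra_simps)
    with f[OF v] sym[OF v] show ?thesis
      unfolding F Fs using pos by (simp add: field_simps)
  qed
  then show ?case by blast
qed

section \<open>Bilinear form of the Laplacian with conductances 1/L\<close>

abbreviation arc_diff :: "('v, 'e) pre_digraph \<Rightarrow> ('v \<Rightarrow> real) \<Rightarrow> 'e \<Rightarrow> real" where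
  "arc_diff G f e \<equiv> f (head G e) - f (tail G e)"

definition energy ::
    "('v, 'e) pre_digraph \<Rightarrow> ('e \<Rightarrow> real) \<Rightarrow> ('v \<Rightarrow> real) \<Rightarrow> ('v \<Rightarrow> real) \<Rightarrow> real" where
  "energy G L f h = (\<Sum>e\<in>arcs G. arc_diff G f e * arc_diff G h e / L e)"

lemma energy_commute: "energy G L f h = energy G L h f"
  by (simp add: energy_def mult.commute)

lemma energy_add: "energy G L f (\<lambda>x. h x + k x) = energy G L f h + energy G L f k"
  by (simp add: energy_def sum.distrib [symmetric] add_divide_distrib algebra_simps diff_divide_distrib)

lemma energy_diff: "energy G L f (\<lambda>x. h x - k x) = energy G L f h - energy G L f k"
  by (simp add: energy_def sum_subtractf [symmetric] add_divide_distrib algebra_simps diff_divide_distrib)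

lemma energy_scale: "energy G L f (\<lambda>x. c * h x) = c * energy G L f h"
  by (simp add: energy_def sum_distrib_left algebra_simps diff_divide_distrib)

lemma energy_sum: "energy G L f (\<lambda>x. \<Sum>v\<in>S. c v * F v x) = (\<Sum>v\<in>S. c v * energy G L f (F v))"
proof (induction S rule: infinite_finite_induct)
  case (insert v S)
  then show ?case by (simp add: energy_add energy_scale)
qed (simp_all add: energy_def)

context metrized_graph
begin

lemma const_if_arc_diff_zero:
  assumes "\<And>e. e \<in> arcs G \<Longrightarrow> f (tail G e) = f (head G e)"
    and "u \<in> verts G" "v \<in> verts G"
  shows "f u = f v"
proof -
  have "u \<rightarrow>\<^sup>*\<^bsub>with_proj (mk_symmetric G)\<^esub> v"
    using connected assms(2,3) by (auto simp: connected_def strongly_connected_def)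
  then show ?thesis
    unfolding reachable_def
  proof (induction rule: rtrancl_on_induct)
    case (step x y)
    then show ?case using assms(1) by (auto simp: mk_symmetric_def)
  qed simp
qed

lemma energy_cong:
  assumes "\<And>v. v \<in> verts G \<Longrightarrow> f v = f' v" "\<And>v. v \<in> verts G \<Longrightarrow> h v = h' v"
  shows "energy G L f h = energy G L f' h'"
  using assms by (auto simp: energy_def intro!: sum.cong)

text \<open>All terms are nonnegative because lengths are positive, so each of them vanishes, and
  connectedness propagates the equality of end values.\<close>

lemma energy_nonpos_imp_const:
  assumes "energy G L f f \<le> 0" "u \<in> verts G" "v \<in> verts G"
  shows "f u = f v"
proof -
  have nonneg: "arc_diff G f e * arc_diff G f e / L e \<ge> 0" if "e \<in> arcs G" for e
    using length_pos[OF that] by simp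
  then have "energy G L f f = 0"
    using assms(1) sum_nonneg[of "arcs G"] unfolding energy_def by (meson antisym)
  then have "\<forall>e\<in>arcs G. arc_diff G f e * arc_diff G f e / L e = 0"
    unfolding energy_def using nonneg by (subst (asm) sum_nonneg_eq_0_iff) auto
  then have "f (tail G e) = f (head G e)" if "e \<in> arcs G" for e
    using length_pos[OF that] that by fastforce
  from const_if_arc_diff_zero[of f, OF this assms(2,3)] show ?thesis .
qed

text \<open>The right-hand side is minus the sum of the slopes leaving \<open>v\<close>, so testing
  against indicators turns the weak equation into Kirchhoff's law.\<close>

lemma energy_delta:
  assumes "h = (\<lambda>x. of_bool (x = v))"
  shows "energy G L h f = (\<Sum>e\<in>in_arcs G v. arc_diff G f e / L e) - (\<Sum>e\<in>out_arcs G v. arc_diff G f e / L e)"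
proof -
  have "energy G L h f = (\<Sum>e\<in>arcs G. of_bool (head G e = v) * (arc_diff G f e / L e))
      - (\<Sum>e\<in>arcs G. of_bool (tail G e = v) * (arc_diff G f e / L e))"
    unfolding energy_def assms sum_subtractf [symmetric]
    by (intro sum.cong) (auto simp: left_diff_distrib diff_divide_distrib)
  moreover have "(\<Sum>e\<in>arcs G. of_bool (head G e = v) * (arc_diff G f e / L e))
      = (\<Sum>e\<in>in_arcs G v. arc_diff G f e / L e)"
    by (rule sum.mono_neutral_cong_right) (auto simp: in_arcs_def)
  moreover have "(\<Sum>e\<in>arcs G. of_bool (tail G e = v) * (arc_diff G f e / L e))
      = (\<Sum>e\<in>out_arcs G v. arc_diff G f e / L e)"
    by (rule sum.mono_neutral_cong_right) (auto simp: out_arcs_def)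
  ultimately show ?thesis by simp
qed

lemma energy_expand_left:
  "energy G L h f = (\<Sum>v\<in>verts G. h v * energy G L (\<lambda>x. of_bool (x = v)) f)"
proof -
  have "(\<Sum>v\<in>verts G. h v * energy G L (\<lambda>x. of_bool (x = v)) f)
      = energy G L (\<lambda>x. \<Sum>v\<in>verts G. h v * of_bool (x = v)) f"
    by (subst (1 2) energy_commute) (rule energy_sum [symmetric])
  also have "\<dots> = energy G L h f"
    by (rule energy_cong) (simp_all add: of_bool_def if_distrib cong: if_cong)
  finally show ?thesis ..
qed

text \<open>The Laplacian without the row and column of \<open>ground\<close> is positive definite.
  Its solution is extended by zero, and the equation at \<open>ground\<close> then comes for free
  because constants have no energy.\<close>

lemma green_exists:
  assumes ground: "ground \<in> verts G" and b: "b \<in> verts G"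
  shows "\<exists>f. f ground = 0 \<and> (\<forall>h. energy G L h f = h b - h ground)"
proof -
  define \<delta> :: "'v \<Rightarrow> 'v \<Rightarrow> real" where "\<delta> v x = of_bool (x = v)" for v x
  define S where "S = verts G - {ground}"
  \<comment> \<open>Extension by zero, written as a combination of indicators so that bilinearity
    applies.\<close>
  define ext where "ext f x = (\<Sum>v\<in>S. f v * \<delta> v x)" for f x
  have ext: "ext f x = (if x \<in> S then f x else 0)" for f x
    by (simp add: ext_def \<delta>_def S_def of_bool_def if_distrib cong: if_cong)
  have form: "(\<Sum>w\<in>S. energy G L h (\<delta> w) * f w) = energy G L h (ext f)" for h f
    unfolding ext_def by (simp add: energy_sum mult.commute)
  have "\<exists>f. \<forall>v\<in>S. (\<Sum>w\<in>S. energy G L (\<delta> v) (\<delta> w) * f w) = of_bool (v = b)"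
  proof (rule positive_definite_solvable)
    show "finite S" by (simp add: S_def)
    show "energy G L (\<delta> v) (\<delta> w) = energy G L (\<delta> w) (\<delta> v)" for v w
      by (rule energy_commute)
    fix f assume le: "(\<Sum>v\<in>S. \<Sum>w\<in>S. f v * energy G L (\<delta> v) (\<delta> w) * f w) \<le> 0"
    have "(\<Sum>v\<in>S. \<Sum>w\<in>S. f v * energy G L (\<delta> v) (\<delta> w) * f w)
        = (\<Sum>v\<in>S. f v * (\<Sum>w\<in>S. energy G L (\<delta> v) (\<delta> w) * f w))"
      by (simp add: sum_distrib_left mult_ac)
    also have "\<dots> = (\<Sum>v\<in>S. f v * energy G L (\<delta> v) (ext f))"
      by (simp only: form)
    also have "\<dots> = (\<Sum>v\<in>S. energy G L (ext f) (\<delta> v) * f v)"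
      by (simp add: energy_commute [of G L "ext f"] mult.commute)
    also have "\<dots> = energy G L (ext f) (ext f)"
      by (rule form)
    finally have "energy G L (ext f) (ext f) \<le> 0"
      using le by simp
    then have "ext f v = ext f ground" if "v \<in> S" for v
      using energy_nonpos_imp_const that ground by (auto simp: S_def)
    then show "\<forall>v\<in>S. f v = 0"
      by (simp add: ext S_def)
  qed
  then obtain f where f: "\<And>v. v \<in> S \<Longrightarrow> energy G L (\<delta> v) (ext f) = of_bool (v = b)"
    unfolding form by blast
  have weak: "energy G L h (ext f) = h b - h ground" for h
  proof -
    \<comment> \<open>The shift leaves the energy unchanged and gives coefficient zero to
      \<open>ground\<close>, the one vertex whose equation has not been solved.\<close>
    have "energy G L h (ext f) = energy G L (\<lambda>x. h x - h ground) (ext f)"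
      by (simp add: energy_def)
    also have "\<dots> = (\<Sum>v\<in>verts G. (h v - h ground) * energy G L (\<delta> v) (ext f))"
      unfolding \<delta>_def by (rule energy_expand_left)
    also have "\<dots> = (\<Sum>v\<in>verts G. (h v - h ground) * of_bool (v = b))"
    proof (intro sum.cong refl)
      fix v assume "v \<in> verts G"
      then show "(h v - h ground) * energy G L (\<delta> v) (ext f) = (h v - h ground) * of_bool (v = b)"
        using f[of v] by (cases "v = ground") (auto simp: S_def)
    qed
    also have "\<dots> = h b - h ground"
      using b by (simp add: of_bool_def if_distrib cong: if_cong)
    finally show ?thesis .
  qed
  moreover have "ext f ground = 0"
    by (simp add: ext S_def)
  ultimately show ?thesis by blast
qed

end

text \<open>The Green function is a parameter with a weak characterisation, so that the graph with
  an edge deleted can be interpreted with an explicit perturbation of the same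
  \<open>g\<close>.\<close>

locale grounded_graph = metrized_graph G L
  for G :: "('v, 'e) pre_digraph" and L :: "'e \<Rightarrow> real" +
  fixes ground :: 'v and g :: "'v \<Rightarrow> 'v \<Rightarrow> real"
  assumes ground: "ground \<in> verts G"
    and green_ground: "b \<in> verts G \<Longrightarrow> g b ground = 0"
    and green: "b \<in> verts G \<Longrightarrow> energy G L h (g b) = h b - h ground"
begin

text \<open>Test the equation of each function against the other; the form is symmetric.\<close>

lemma green_sym: "a \<in> verts G \<Longrightarrow> b \<in> verts G \<Longrightarrow> g a b = g b a"
  using green[of a "g b"] green[of b "g a"] green_ground energy_commute[of G L "g a" "g b"] by simp

text \<open>For an arc \<open>e\<close>, the potential, zero at the ground, of a unit current that
  enters at the head of \<open>e\<close> and leaves at its tail.\<close>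

definition dipole :: "'e \<Rightarrow> 'v \<Rightarrow> real" where
  "dipole e x = g (head G e) x - g (tail G e) x"

text \<open>The effective resistance between the ends of \<open>e\<close> in the whole graph, i.e. \<open>L R / (L + R)\<close>
  in terms of the resistance \<open>R\<close> of the graph without \<open>e\<close>.\<close>

definition edge_res :: "'e \<Rightarrow> real" where
  "edge_res e = arc_diff G (dipole e) e"

lemma energy_dipole: "e \<in> arcs G \<Longrightarrow> energy G L h (dipole e) = arc_diff G h e"
  unfolding dipole_def by (simp add: energy_diff green)

lemma dipole_eq_arc_diff: "e \<in> arcs G \<Longrightarrow> v \<in> verts G \<Longrightarrow> dipole e v = arc_diff G (g v) e"
  by (simp add: dipole_def green_sym)

text \<open>Reciprocity: both sides are the same mixed second difference of the symmetric
  \<open>g\<close>.\<close>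

lemma arc_diff_dipole_commute:
  "e \<in> arcs G \<Longrightarrow> k \<in> arcs G \<Longrightarrow> arc_diff G (dipole e) k = arc_diff G (dipole k) e"
  by (simp add: dipole_def green_sym)

lemma edge_res_eq:
  "e \<in> arcs G \<Longrightarrow> edge_res e = g (head G e) (head G e) + g (tail G e) (tail G e) - 2 * g (tail G e) (head G e)"
  by (simp add: edge_res_def dipole_def green_sym[of "head G e" "tail G e"])

text \<open>The power dissipated by a unit current is the effective resistance: test the dipole's
  equation against the dipole itself.\<close>

lemma sum_arc_diff_dipole_sq:
  "e \<in> arcs G \<Longrightarrow> (\<Sum>k\<in>arcs G. (arc_diff G (dipole e) k)\<^sup>2 / L k) = edge_res e"
  using energy_dipole[of e "dipole e"] by (simp add: energy_def edge_res_def power2_eq_square)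

end

lemma (in metrized_graph) grounded_graph_exists: "\<exists>ground g. grounded_graph G L ground g"
proof -
  obtain ground where ground: "ground \<in> verts G"
    using connected by (auto simp: connected_def strongly_connected_def)
  obtain g where "\<And>b. b \<in> verts G \<Longrightarrow> g b ground = 0 \<and> (\<forall>h. energy G L h (g b) = h b - h ground)"
    using green_exists[OF ground] by metis
  then have "grounded_graph G L ground g"
    by unfold_locales (use ground in auto)
  then show ?thesis by blast
qed

section \<open>Deleting an edge\<close>

context grounded_graph
begin

text \<open>Deleting \<open>e\<close> lowers the energy of its dipole from \<open>edge_res e\<close>
  by \<open>(edge_res e)\<^sup>2 / L e\<close>. If the result were not positive, connectedness of
  the remaining graph would make the dipole constant, against its drop of at least
  \<open>L e\<close> along \<open>e\<close>.\<close>

lemma edge_res_less: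
  assumes e: "e \<in> arcs G" and H: "metrized_graph (del_arc e) L"
  shows "edge_res e < L e"
proof (rule ccontr)
  interpret H: metrized_graph "del_arc e" L by (rule H)
  assume "\<not> edge_res e < L e"
  then have le: "L e \<le> edge_res e" by simp
  have "energy (del_arc e) L (dipole e) (dipole e) = energy G L (dipole e) (dipole e) - (edge_res e)\<^sup>2 / L e"
    using e by (simp add: energy_def sum_diff1 edge_res_def power2_eq_square)
  also have "\<dots> = edge_res e * (L e - edge_res e) / L e"
    using e length_pos[OF e]
    by (simp add: energy_dipole edge_res_def [symmetric] field_simps power2_eq_square)
  also have "\<dots> \<le> 0"
    using le length_pos[OF e] by (intro divide_nonpos_pos mult_nonneg_nonpos) auto
  finally have "dipole e (tail G e) = dipole e (head G e)"
    using e by (intro H.energy_nonpos_imp_const) auto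
  then show False
    using le length_pos[OF e] by (simp add: edge_res_def)
qed

text \<open>Deleting an edge is a rank-one perturbation of the energy form, so this is the
  Sherman--Morrison formula.\<close>

lemma grounded_graph_del_arc:
  assumes e: "e \<in> arcs G" and H: "metrized_graph (del_arc e) L"
  shows "grounded_graph (del_arc e) L ground (\<lambda>a b. g a b + dipole e a * dipole e b / (L e - edge_res e))"
    (is "grounded_graph _ _ _ ?g")
proof -
  interpret H: metrized_graph "del_arc e" L by (rule H)
  have pos: "0 < L e" "0 < L e - edge_res e"
    using edge_res_less[OF e H] length_pos[OF e] by auto
  have dg: "dipole e ground = 0"
    using e by (simp add: dipole_def green_ground)
  show ?thesis
  proof unfold_locales
    show "ground \<in> verts (del_arc e)"
      using ground by simp
    fix b assume b: "b \<in> verts (del_arc e)"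
    show "?g b ground = 0"
      using b dg by (simp add: green_ground)
    fix h
    have "energy (del_arc e) L h (?g b) = energy G L h (?g b) - arc_diff G h e * arc_diff G (?g b) e / L e"
      using e by (simp add: energy_def sum_diff1)
    also have "energy G L h (?g b) = h b - h ground + dipole e b / (L e - edge_res e) * arc_diff G h e"
    proof -
      have "?g b = (\<lambda>x. g b x + dipole e b / (L e - edge_res e) * dipole e x)"
        by auto
      then show ?thesis
        using b e by (simp only: energy_add energy_scale energy_dipole green verts_del_arc)
    qed
    also have "arc_diff G (?g b) e = dipole e b + dipole e b / (L e - edge_res e) * edge_res e"
      using b e dipole_eq_arc_diff[of e b]
      by (simp add: edge_res_def diff_divide_distrib algebra_simps)
    also have "h b - h ground + dipole e b / (L e - edge_res e) * arc_diff G h e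
        - arc_diff G h e * (dipole e b + dipole e b / (L e - edge_res e) * edge_res e) / L e = h b - h ground"
    proof -
      have "dipole e b + dipole e b / (L e - edge_res e) * edge_res e = dipole e b / (L e - edge_res e) * L e"
        using pos by (simp add: field_simps)
      then show ?thesis
        using pos by simp
    qed
    finally show "energy (del_arc e) L h (?g b) = h b - h ground" .
  qed
qed

text \<open>The voltage \<open>j\<^sub>x(p, q)\<close> for the ends \<open>p\<close>, \<open>q\<close> of \<open>e\<close>.\<close>

definition star_leg :: "'e \<Rightarrow> 'v \<Rightarrow> real" where
  "star_leg e x = g (tail G e) (head G e) - g (tail G e) x - g x (head G e) + g x x"

text \<open>A discrete Leibniz rule on each edge writes the summand as twice the drop of
  \<open>dipole e * g a\<close> times the current of \<open>dipole e\<close>, minus the drop of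
  \<open>(dipole e)\<^sup>2\<close> times the current of \<open>g a\<close>. Both currents have
  known sources, which evaluates the two energies.\<close>

lemma sum_arc_diff_dipole_sq_green:
  assumes e: "e \<in> arcs G" and a: "a \<in> verts G"
  shows "(\<Sum>k\<in>arcs G. (arc_diff G (dipole e) k)\<^sup>2 / L k * (g a (tail G k) + g a (head G k)))
    = 2 * arc_diff G (\<lambda>x. dipole e x * g a x) e - (dipole e a)\<^sup>2"
proof -
  have "(\<Sum>k\<in>arcs G. (arc_diff G (dipole e) k)\<^sup>2 / L k * (g a (tail G k) + g a (head G k)))
    = 2 * energy G L (\<lambda>x. dipole e x * g a x) (dipole e) - energy G L (\<lambda>x. (dipole e x)\<^sup>2) (g a)"
    unfolding energy_def sum_distrib_left sum_subtractf [symmetric]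
  proof (intro sum.cong refl)
    fix k assume "k \<in> arcs G"
    then show "(arc_diff G (dipole e) k)\<^sup>2 / L k * (g a (tail G k) + g a (head G k))
      = 2 * (arc_diff G (\<lambda>x. dipole e x * g a x) k * arc_diff G (dipole e) k / L k)
       - arc_diff G (\<lambda>x. (dipole e x)\<^sup>2) k * arc_diff G (g a) k / L k"
      using length_pos[of k] by (simp add: divide_simps) algebra
  qed
  also have "\<dots> = 2 * arc_diff G (\<lambda>x. dipole e x * g a x) e - (dipole e a)\<^sup>2"
    using e a by (simp add: energy_dipole green dipole_def green_ground)
  finally show ?thesis .
qed

text \<open>The summand is the drop along \<open>k\<close> of the cubic \<open>u\<^sup>3 / 3 - \<rho> u\<^sup>2 / 2\<close>, times the current in \<open>k\<close>.\<close>

lemma sum_cubic_dipole: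
  assumes e: "e \<in> arcs G"
  defines "u \<equiv> \<lambda>x. dipole e x - dipole e (tail G e)"
  shows "(\<Sum>k\<in>arcs G. (arc_diff G (dipole e) k)\<^sup>2 / L k *
      ((u (tail G k) * (u (tail G k) - edge_res e) + u (head G k) * (u (head G k) - edge_res e)) / 2
        - (arc_diff G (dipole e) k)\<^sup>2 / 6)) = - (edge_res e ^ 3) / 6"
proof -
  define h where "h x = (u x) ^ 3 / 3 - edge_res e * (u x)\<^sup>2 / 2" for x
  have diff: "arc_diff G (dipole e) k = u (head G k) - u (tail G k)" for k
    by (simp add: u_def)
  have "(\<Sum>k\<in>arcs G. (arc_diff G (dipole e) k)\<^sup>2 / L k *
      ((u (tail G k) * (u (tail G k) - edge_res e) + u (head G k) * (u (head G k) - edge_res e)) / 2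
        - (arc_diff G (dipole e) k)\<^sup>2 / 6)) = energy G L h (dipole e)"
    unfolding energy_def
  proof (intro sum.cong refl)
    fix k assume "k \<in> arcs G"
    then show "(arc_diff G (dipole e) k)\<^sup>2 / L k *
      ((u (tail G k) * (u (tail G k) - edge_res e) + u (head G k) * (u (head G k) - edge_res e)) / 2
        - (arc_diff G (dipole e) k)\<^sup>2 / 6) = arc_diff G h k * arc_diff G (dipole e) k / L k"
      unfolding h_def diff using length_pos[of k] by (simp add: divide_simps) algebra
  qed
  also have "\<dots> = arc_diff G h e"
    using e by (rule energy_dipole)
  also have "\<dots> = - (edge_res e ^ 3) / 6"
  proof -
    have "u (head G e) = edge_res e" "u (tail G e) = 0"
      by (simp_all add: u_def edge_res_def)
    then show ?thesis
      by (simp add: h_def power2_eq_square power3_eq_cube)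
  qed
  finally show ?thesis .
qed

text \<open>This is \<open>L\<^sub>e\<close> times the summand of \<open>e\<close> in the theorem, in terms of the Green function of the
  graph that still contains \<open>e\<close>.\<close>

definition deletion_sum :: "'e \<Rightarrow> real" where
  "deletion_sum e = (\<Sum>k\<in>arcs G - {e}. (arc_diff G (dipole e) k)\<^sup>2 / L k *
     ((star_leg e (tail G k) + star_leg e (head G k)) / 2 + (L k - edge_res k) / 6 +
      ((dipole e (tail G k) - dipole e (tail G e)) * (dipole e (tail G k) - dipole e (head G e)) / 2
       + (dipole e (head G k) - dipole e (tail G e)) * (dipole e (head G k) - dipole e (head G e)) / 2
       - (arc_diff G (dipole e) k)\<^sup>2 / 6) / (L e - edge_res e)))"

text \<open>The sum is completed by the term of \<open>e\<close>. The part divided by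
  \<open>L e - edge_res e\<close> then has a closed form by \<open>sum_cubic_dipole\<close>, and
  together with the added term this denominator cancels.\<close>

lemma deletion_sum_eq:
  assumes e: "e \<in> arcs G" and less: "edge_res e < L e"
  shows "deletion_sum e = (\<Sum>k\<in>arcs G. (arc_diff G (dipole e) k)\<^sup>2 / L k *
     ((star_leg e (tail G k) + star_leg e (head G k)) / 2 + (L k - edge_res k) / 6)) - (edge_res e)\<^sup>2 / 6"
    (is "_ = sum ?Y _ - _")
proof -
  define u where "u x = dipole e x - dipole e (tail G e)" for x
  have uq: "dipole e x - dipole e (head G e) = u x - edge_res e" for x
    by (simp add: u_def edge_res_def)
  let ?Z = "\<lambda>k. (arc_diff G (dipole e) k)\<^sup>2 / L k *
      ((u (tail G k) * (u (tail G k) - edge_res e) + u (head G k) * (u (head G k) - edge_res e)) / 2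
        - (arc_diff G (dipole e) k)\<^sup>2 / 6)"
  have pos: "0 < L e" "0 < L e - edge_res e"
    using length_pos[OF e] less by auto
  have "deletion_sum e = (\<Sum>k\<in>arcs G - {e}. ?Y k + ?Z k / (L e - edge_res e))"
    unfolding deletion_sum_def uq u_def [symmetric]
    by (intro sum.cong refl) (simp add: algebra_simps add_divide_distrib diff_divide_distrib)
  also have "\<dots> = (\<Sum>k\<in>arcs G. ?Y k + ?Z k / (L e - edge_res e)) - (?Y e + ?Z e / (L e - edge_res e))"
    using e by (simp add: sum_diff1)
  also have "\<dots> = sum ?Y (arcs G) - edge_res e ^ 3 / 6 / (L e - edge_res e) - (?Y e + ?Z e / (L e - edge_res e))"
  proof -
    have "sum ?Z (arcs G) = - (edge_res e ^ 3) / 6"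
      using sum_cubic_dipole[OF e] unfolding u_def .
    then show ?thesis
      unfolding sum.distrib sum_divide_distrib [symmetric] by simp
  qed
  \<comment> \<open>\<open>star_leg e\<close> vanishes at both ends of \<open>e\<close>; in
    \<open>?Z e\<close> the products with \<open>u\<close> vanish there as well.\<close>
  also have "?Y e = (edge_res e)\<^sup>2 / L e * ((L e - edge_res e) / 6)"
    using e by (simp add: star_leg_def edge_res_def [symmetric] green_sym[of "head G e" "tail G e"])
  also have "?Z e = - (edge_res e ^ 4) / (6 * L e)"
  proof -
    have "u (head G e) = edge_res e" "u (tail G e) = 0"
      by (simp_all add: u_def edge_res_def)
    then show ?thesis
      by (simp add: edge_res_def [symmetric] power4_eq_xxxx power2_eq_square)
  qed
  also have "sum ?Y (arcs G) - edge_res e ^ 3 / 6 / (L e - edge_res e)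
      - ((edge_res e)\<^sup>2 / L e * ((L e - edge_res e) / 6) + - (edge_res e ^ 4) / (6 * L e) / (L e - edge_res e))
      = sum ?Y (arcs G) - (edge_res e)\<^sup>2 / 6"
  proof -
    have "edge_res e ^ 3 / 6 / (L e - edge_res e)
      + ((edge_res e)\<^sup>2 / L e * ((L e - edge_res e) / 6) + - (edge_res e ^ 4) / (6 * L e) / (L e - edge_res e))
      = (edge_res e)\<^sup>2 / 6"
      using pos by (simp add: divide_simps) algebra
    then show ?thesis by linarith
  qed
  finally show ?thesis .
qed

text \<open>Expanding \<open>star_leg\<close> leaves sums over \<open>k\<close> that are known for
  each \<open>e\<close>, and a part whose second factor depends on \<open>k\<close> alone; the
  latter is summed over \<open>e\<close> first. What results is an identity for each edge
  separately.\<close>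

lemma sum_deletion_sum:
  assumes less: "\<And>e. e \<in> arcs G \<Longrightarrow> edge_res e < L e"
  shows "energy G L (\<lambda>v. g v v) (\<lambda>v. g v v) + (\<Sum>e\<in>arcs G. L e / 3 * (1 - edge_res e / L e)\<^sup>2)
    = 4 * (total_length G L / 12 - (\<Sum>e\<in>arcs G. deletion_sum e / L e))"
proof -
  define a b c where "a e = g (tail G e) (tail G e)" and "b e = g (tail G e) (head G e)"
    and "c e = g (head G e) (head G e)" for e
  define T where "T e k = (arc_diff G (dipole e) k)\<^sup>2 / L k" for e k
  \<comment> \<open>The part of the second factor that depends on \<open>k\<close> only.\<close>
  define M where "M k = (a k + c k) / 2 + (L k - edge_res k) / 6" for k
  have rho: "edge_res e = a e + c e - 2 * b e" if "e \<in> arcs G" for e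
    using edge_res_eq[OF that] by (simp add: a_def b_def c_def)
  have row: "(\<Sum>k\<in>arcs G. T e k) = edge_res e" if "e \<in> arcs G" for e
    unfolding T_def by (rule sum_arc_diff_dipole_sq[OF that])
  \<comment> \<open>By reciprocity \<open>T e k / L e = T k e / L k\<close>, so column sums reduce
    to row sums.\<close>
  have column: "(\<Sum>e\<in>arcs G. T e k / L e) = edge_res k / L k" if k: "k \<in> arcs G" for k
  proof -
    have "(\<Sum>e\<in>arcs G. T e k / L e) = (\<Sum>e\<in>arcs G. T k e) / L k"
      unfolding sum_divide_distrib
      by (intro sum.cong refl) (simp add: T_def arc_diff_dipole_commute[OF _ k])
    then show ?thesis by (simp add: row k)
  qed
  have legs: "deletion_sum e = edge_res e * b e
      - ((a e)\<^sup>2 + (c e)\<^sup>2 - 6 * (b e)\<^sup>2 + 2 * a e * b e + 2 * b e * c e) / 2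
      + (\<Sum>k\<in>arcs G. T e k * M k) - (edge_res e)\<^sup>2 / 6" if e: "e \<in> arcs G" for e
  proof -
    let ?p = "tail G e" and ?q = "head G e"
    have "deletion_sum e = (\<Sum>k\<in>arcs G. T e k * b e
        - (T e k * (g ?p (tail G k) + g ?p (head G k)) + T e k * (g ?q (tail G k) + g ?q (head G k))) / 2
        + T e k * M k) - (edge_res e)\<^sup>2 / 6"
      unfolding deletion_sum_eq[OF e less[OF e]] T_def [symmetric]
      by (intro arg_cong2[where f="(-)"] sum.cong refl)
         (simp add: star_leg_def M_def a_def b_def c_def green_sym[of _ ?q] e field_simps)
    also have "\<dots> = (\<Sum>k\<in>arcs G. T e k) * b e
        - ((\<Sum>k\<in>arcs G. T e k * (g ?p (tail G k) + g ?p (head G k)))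
            + (\<Sum>k\<in>arcs G. T e k * (g ?q (tail G k) + g ?q (head G k)))) / 2
        + (\<Sum>k\<in>arcs G. T e k * M k) - (edge_res e)\<^sup>2 / 6"
      by (simp add: sum.distrib sum_subtractf sum_divide_distrib [symmetric] sum_distrib_right [symmetric])
    also have "(\<Sum>k\<in>arcs G. T e k * (g ?p (tail G k) + g ?p (head G k)))
        = 2 * arc_diff G (\<lambda>x. dipole e x * g ?p x) e - (dipole e ?p)\<^sup>2"
      unfolding T_def using e by (intro sum_arc_diff_dipole_sq_green) auto
    also have "(\<Sum>k\<in>arcs G. T e k * (g ?q (tail G k) + g ?q (head G k)))
        = 2 * arc_diff G (\<lambda>x. dipole e x * g ?q x) e - (dipole e ?q)\<^sup>2"
      unfolding T_def using e by (intro sum_arc_diff_dipole_sq_green) auto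
    also have "2 * arc_diff G (\<lambda>x. dipole e x * g ?p x) e - (dipole e ?p)\<^sup>2
        + (2 * arc_diff G (\<lambda>x. dipole e x * g ?q x) e - (dipole e ?q)\<^sup>2)
        = (a e)\<^sup>2 + (c e)\<^sup>2 - 6 * (b e)\<^sup>2 + 2 * a e * b e + 2 * b e * c e"
    proof -
      have "g ?q ?p = b e"
        using e by (simp add: b_def green_sym[of ?q])
      then show ?thesis
        unfolding dipole_def a_def [symmetric] b_def [symmetric] c_def [symmetric]
        by (simp add: power2_eq_square algebra_simps)
    qed
    finally show ?thesis
      by (simp add: row e)
  qed
  have swap: "(\<Sum>e\<in>arcs G. (\<Sum>k\<in>arcs G. T e k * M k) / L e) = (\<Sum>e\<in>arcs G. edge_res e / L e * M e)"
  proof -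
    have "(\<Sum>e\<in>arcs G. (\<Sum>k\<in>arcs G. T e k * M k) / L e) = (\<Sum>k\<in>arcs G. (\<Sum>e\<in>arcs G. T e k / L e) * M k)"
      unfolding sum_divide_distrib sum_distrib_right by (subst sum.swap) simp
    then show ?thesis by (simp add: column)
  qed
  have "(\<Sum>e\<in>arcs G. deletion_sum e / L e) = (\<Sum>e\<in>arcs G. (edge_res e * b e
      - ((a e)\<^sup>2 + (c e)\<^sup>2 - 6 * (b e)\<^sup>2 + 2 * a e * b e + 2 * b e * c e) / 2 - (edge_res e)\<^sup>2 / 6) / L e)
      + (\<Sum>e\<in>arcs G. (\<Sum>k\<in>arcs G. T e k * M k) / L e)"
    unfolding sum.distrib [symmetric]
    by (intro sum.cong refl) (simp add: legs add_divide_distrib diff_divide_distrib)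
  also have "\<dots> = (\<Sum>e\<in>arcs G. (edge_res e * b e
      - ((a e)\<^sup>2 + (c e)\<^sup>2 - 6 * (b e)\<^sup>2 + 2 * a e * b e + 2 * b e * c e) / 2 - (edge_res e)\<^sup>2 / 6) / L e
      + edge_res e / L e * M e)"
    unfolding swap sum.distrib ..
  finally have del: "(\<Sum>e\<in>arcs G. deletion_sum e / L e) = \<dots>" .
  show ?thesis
    unfolding del energy_def total_length_def sum.distrib [symmetric] sum_divide_distrib
      sum_subtractf [symmetric] sum_distrib_left
  \<comment> \<open>After substituting \<open>edge_res e = a e + c e - 2 * b e\<close>, a polynomial
    identity in \<open>a e\<close>, \<open>b e\<close>, \<open>c e\<close> and \<open>L e\<close>
    remains.\<close>
  proof (intro sum.cong refl)
    fix e assume e: "e \<in> arcs G"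
    show "arc_diff G (\<lambda>v. g v v) e * arc_diff G (\<lambda>v. g v v) e / L e + L e / 3 * (1 - edge_res e / L e)\<^sup>2
      = 4 * (L e / 12 - ((edge_res e * b e
          - ((a e)\<^sup>2 + (c e)\<^sup>2 - 6 * (b e)\<^sup>2 + 2 * a e * b e + 2 * b e * c e) / 2 - (edge_res e)\<^sup>2 / 6) / L e
          + edge_res e / L e * M e))"
      unfolding M_def rho[OF e] a_def [symmetric] c_def [symmetric]
      using length_pos[OF e] by (simp add: divide_simps) algebra
  qed
qed

end

section \<open>Potentials on the points of a metrized graph\<close>

lemma at_right_slope_if_affine:
  fixes h :: "real \<Rightarrow> real"
  assumes "t < b" and eq: "\<And>x. x \<in> {t..b} \<Longrightarrow> h x = h t + c * (x - t)"
  shows "(h has_vector_derivative c) (at_right t)"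
proof -
  have "((\<lambda>x. h t + c * (x - t)) has_vector_derivative c) (at t within {t..b})"
    by (auto intro!: derivative_eq_intros simp: has_real_derivative_iff_has_vector_derivative [symmetric])
  then have "(h has_vector_derivative c) (at t within {t..b})"
    by (rule has_vector_derivative_transform [rotated 2, OF _ _ eq]) (use assms(1) in simp_all)
  then show ?thesis
    using assms(1) by (simp add: at_within_Icc_at_right)
qed

lemma at_left_slope_if_affine:
  fixes h :: "real \<Rightarrow> real"
  assumes "a < t" and eq: "\<And>x. x \<in> {a..t} \<Longrightarrow> h x = h t + c * (x - t)"
  shows "(h has_vector_derivative c) (at_left t)"
proof -
  have "((\<lambda>x. h t + c * (x - t)) has_vector_derivative c) (at t within {a..t})"
    by (auto intro!: derivative_eq_intros simp: has_real_derivative_iff_has_vector_derivative [symmetric])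
  then have "(h has_vector_derivative c) (at t within {a..t})"
    by (rule has_vector_derivative_transform [rotated 2, OF _ _ eq]) (use assms(1) in simp_all)
  then show ?thesis
    using assms(1) by (simp add: at_within_Icc_at_left)
qed

lemma vector_derivative_at_right:
  fixes h :: "real \<Rightarrow> real"
  shows "(h has_vector_derivative c) (at_right t) \<Longrightarrow> vector_derivative h (at_right t) = c"
  by (rule vector_derivative_within) auto

lemma vector_derivative_at_left:
  fixes h :: "real \<Rightarrow> real"
  shows "(h has_vector_derivative c) (at_left t) \<Longrightarrow> vector_derivative h (at_left t) = c"
  by (rule vector_derivative_within) auto

text \<open>Without kinks the one-sided pieces join to two-sided ones, so the derivative is locally
  constant and hence constant on the open interval. One-sided affinity at the ends gives the
  continuity that extends the formula to the closed interval.\<close>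

lemma affine_if_locally_affine:
  fixes h :: "real \<Rightarrow> real"
  assumes "0 < l"
    and right: "\<And>t. 0 \<le> t \<Longrightarrow> t < l \<Longrightarrow> \<exists>b c. t < b \<and> b \<le> l \<and> (\<forall>x\<in>{t..b}. h x = h t + c * (x - t))"
    and left: "\<And>t. 0 < t \<Longrightarrow> t \<le> l \<Longrightarrow> \<exists>a c. 0 \<le> a \<and> a < t \<and> (\<forall>x\<in>{a..t}. h x = h t + c * (x - t))"
    and no_kink: "\<And>t. 0 < t \<Longrightarrow> t < l \<Longrightarrow> vector_derivative h (at_right t) = vector_derivative h (at_left t)"
  shows "\<exists>c. \<forall>t\<in>{0..l}. h t = h 0 + c * t"
proof -
  have nbhd: "\<exists>a b c. 0 \<le> a \<and> a < t \<and> t < b \<and> b \<le> l \<and> (\<forall>x\<in>{a..b}. h x = h t + c * (x - t))"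
    if t: "0 < t" "t < l" for t
  proof -
    obtain b c where b: "t < b" "b \<le> l" and right_eq: "\<forall>x\<in>{t..b}. h x = h t + c * (x - t)"
      using right[OF less_imp_le[OF t(1)] t(2)] by (elim exE conjE) (rule that)
    obtain a d where a: "0 \<le> a" "a < t" and left_eq: "\<forall>x\<in>{a..t}. h x = h t + d * (x - t)"
      using left[OF t(1) less_imp_le[OF t(2)]] by (elim exE conjE) (rule that)
    have "vector_derivative h (at_right t) = c"
      by (rule vector_derivative_at_right, rule at_right_slope_if_affine[OF b(1) bspec[OF right_eq]])
    moreover have "vector_derivative h (at_left t) = d"
      by (rule vector_derivative_at_left, rule at_left_slope_if_affine[OF a(2) bspec[OF left_eq]])
    ultimately have "c = d"
      using no_kink[OF t] by simp
    have "h x = h t + c * (x - t)" if x: "x \<in> {a..b}" for x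
    proof (cases "x \<le> t")
      case True
      then show ?thesis
        unfolding \<open>c = d\<close> using x by (intro bspec[OF left_eq]) simp
    next
      case False
      then show ?thesis
        using x by (intro bspec[OF right_eq]) simp
    qed
    then show ?thesis using a b by blast
  qed
  have deriv_at: "\<exists>a b c. 0 \<le> a \<and> a < t \<and> t < b \<and> b \<le> l \<and> (\<forall>x\<in>{a<..<b}. (h has_real_derivative c) (at x))"
    if t: "0 < t" "t < l" for t
  proof -
    obtain a b c where ab: "0 \<le> a" "a < t" "t < b" "b \<le> l" and
      eq: "\<forall>x\<in>{a..b}. h x = h t + c * (x - t)"
      using nbhd[OF t] by (elim exE conjE) (rule that)
    have "(h has_real_derivative c) (at x)" if "x \<in> {a<..<b}" for x
    proof (rule has_field_derivative_transform_within_open)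
      show "((\<lambda>x. h t + c * (x - t)) has_real_derivative c) (at x)"
        by (auto intro!: derivative_eq_intros)
      show "open {a<..<b}" "x \<in> {a<..<b}"
        using that by auto
      show "h t + c * (y - t) = h y" if "y \<in> {a<..<b}" for y
        using that by (intro bspec[OF eq, symmetric]) simp
    qed
    then show ?thesis using ab by blast
  qed
  have "\<exists>c. \<forall>t\<in>{0<..<l}. deriv h t = c"
  proof (rule has_field_derivative_zero_constant)
    fix t assume t: "t \<in> {0<..<l}"
    then have t': "0 < t" "t < l" by auto
    obtain a b c where ab: "0 \<le> a" "a < t" "t < b" "b \<le> l" and
      eq: "\<forall>x\<in>{a<..<b}. (h has_real_derivative c) (at x)"
      using deriv_at[OF t'] by (elim exE conjE) (rule that)
    have "(deriv h has_real_derivative 0) (at t)"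
    proof (rule has_field_derivative_transform_within_open)
      show "((\<lambda>x. c) has_real_derivative 0) (at t)" by simp
      show "open {a<..<b}" "t \<in> {a<..<b}"
        using ab by auto
      show "c = deriv h y" if "y \<in> {a<..<b}" for y
        using bspec[OF eq that] by (simp add: DERIV_imp_deriv)
    qed
    then show "(deriv h has_real_derivative 0) (at t within {0<..<l})"
      by (rule has_field_derivative_at_within)
  qed simp
  then obtain c where c: "\<And>t. t \<in> {0<..<l} \<Longrightarrow> deriv h t = c"
    by blast
  have h': "(h has_real_derivative c) (at t)" if t: "0 < t" "t < l" for t
  proof -
    obtain a b d where "a < t" "t < b" "\<forall>x\<in>{a<..<b}. (h has_real_derivative d) (at x)"
      using deriv_at[OF t] by (elim exE conjE) (rule that)
    then have "(h has_real_derivative d) (at t)" by simp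
    with c[of t] t show ?thesis
      by (auto dest: DERIV_imp_deriv)
  qed
  have cont: "continuous_on {0..l} h"
    unfolding continuous_on_eq_continuous_within
  proof
    fix t assume "t \<in> {0..l}"
    then consider "t = 0" | "t = l" | "0 < t" "t < l" by fastforce
    then show "continuous (at t within {0..l}) h"
    proof cases
      case 1
      obtain b d where b: "0 < b" and eq: "\<forall>x\<in>{0..b}. h x = h 0 + d * (x - 0)"
        using right[OF order_refl \<open>0 < l\<close>] by (elim exE conjE) (rule that)
      have "(h has_vector_derivative d) (at_right 0)"
        by (rule at_right_slope_if_affine[OF b bspec[OF eq]])
      then show ?thesis
        using 1 \<open>0 < l\<close> by (simp add: at_within_Icc_at_right has_vector_derivative_continuous)
    next
      case 2
      obtain a d where a: "a < l" and eq: "\<forall>x\<in>{a..l}. h x = h l + d * (x - l)"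
        using left[OF \<open>0 < l\<close> order_refl] by (elim exE conjE) (rule that)
      have "(h has_vector_derivative d) (at_left l)"
        by (rule at_left_slope_if_affine[OF a bspec[OF eq]])
      then show ?thesis
        using 2 \<open>0 < l\<close> by (simp add: at_within_Icc_at_left has_vector_derivative_continuous)
    next
      case 3
      then show ?thesis
        using h'[of t] DERIV_isCont continuous_at_imp_continuous_at_within by blast
    qed
  qed
  have const: "h t - c * t = h 0 - c * 0" if "t \<in> {0..l}" for t
  proof (rule DERIV_isconst2[where f = "\<lambda>t. h t - c * t" and b = l])
    show "continuous_on {0..l} (\<lambda>t. h t - c * t)"
      by (intro continuous_intros cont)
    show "((\<lambda>t. h t - c * t) has_real_derivative 0) (at x)" if "0 < x" "x < l" for x
      using h'[OF that] by (auto intro!: derivative_eq_intros)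
  qed (use that \<open>0 < l\<close> in auto)
  show ?thesis
  proof (intro exI[of _ c] ballI)
    fix t assume "t \<in> {0..l}"
    from const[OF this] show "h t = h 0 + c * t" by simp
  qed
qed

text \<open>The Ohm clause of \<open>unit_current_potential\<close> with an arbitrary exceptional
  set, so that potentials with different poles can be subtracted over a common set.\<close>

definition ohm ::
    "('v, 'e) pre_digraph \<Rightarrow> ('e \<Rightarrow> real) \<Rightarrow> ('v, 'e) point set \<Rightarrow> (('v, 'e) point \<Rightarrow> real) \<Rightarrow> bool" where
  "ohm G L S f \<longleftrightarrow>
     (\<forall>e \<in> arcs G. \<forall>a b. 0 \<le> a \<longrightarrow> a \<le> b \<longrightarrow> b \<le> L e \<longrightarrow>
        (\<forall>t \<in> {a<..<b}. edge_point G L e t \<notin> S) \<longrightarrow>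
        (\<exists>c. \<forall>t \<in> {a..b}. f (edge_point G L e t) = f (edge_point G L e a) + c * (t - a)))"

lemma unit_current_potential_iff_ohm:
  "unit_current_potential G L y z f \<longleftrightarrow> f z = 0 \<and> ohm G L {y, z} f \<and>
     (\<forall>x \<in> points G L. - slope_sum G L f x = of_bool (x = y) - of_bool (x = z))"
  by (simp add: unit_current_potential_def ohm_def)

lemma ohm_mono: "ohm G L S f \<Longrightarrow> S \<subseteq> S' \<Longrightarrow> ohm G L S' f"
  unfolding ohm_def by (meson in_mono)

lemma ohm_const: "ohm G L S (\<lambda>x. k)"
  unfolding ohm_def by (auto intro: exI[of _ 0])

lemma ohm_diff:
  assumes "ohm G L S f" "ohm G L S h"
  shows "ohm G L S (\<lambda>x. f x - h x)"
  unfolding ohm_def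
proof (intro ballI allI impI)
  fix e a b assume *: "e \<in> arcs G" "0 \<le> a" "a \<le> b" "b \<le> L e" "\<forall>t\<in>{a<..<b}. edge_point G L e t \<notin> S"
  obtain c where c: "\<forall>t \<in> {a..b}. f (edge_point G L e t) = f (edge_point G L e a) + c * (t - a)"
    using assms(1) * unfolding ohm_def by meson
  obtain d where d: "\<forall>t \<in> {a..b}. h (edge_point G L e t) = h (edge_point G L e a) + d * (t - a)"
    using assms(2) * unfolding ohm_def by meson
  show "\<exists>c. \<forall>t\<in>{a..b}. f (edge_point G L e t) - h (edge_point G L e t)
      = f (edge_point G L e a) - h (edge_point G L e a) + c * (t - a)"
  proof (intro exI[of _ "c - d"] ballI)
    fix t assume "t \<in> {a..b}"
    from bspec[OF c this] bspec[OF d this]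
    show "f (edge_point G L e t) - h (edge_point G L e t)
        = f (edge_point G L e a) - h (edge_point G L e a) + (c - d) * (t - a)"
      by (simp add: algebra_simps)
  qed
qed

lemma finite_edge_point_preimage:
  assumes "finite S"
  shows "finite {t. 0 < t \<and> t < L e \<and> edge_point G L e t \<in> S}"
proof -
  have "inj_on (edge_point G L e) {0<..<L e}"
    by (auto simp: inj_on_def edge_point_def)
  from finite_vimage_IntI[OF assms this] show ?thesis
    by (rule rev_finite_subset) auto
qed

lemma ohm_affine_right:
  assumes S: "finite S" and f: "ohm G L S f" and e: "e \<in> arcs G" and t: "0 \<le> t" "t < L e"
  shows "\<exists>b c. t < b \<and> b \<le> L e \<and>
    (\<forall>x\<in>{t..b}. f (edge_point G L e x) = f (edge_point G L e t) + c * (x - t))"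
proof -
  \<comment> \<open>The exceptional points beyond \<open>t\<close>; including \<open>L e\<close>
    makes the set nonempty, so its minimum is the next place where affinity may fail.\<close>
  define F where "F = insert (L e) {x. 0 < x \<and> x < L e \<and> edge_point G L e x \<in> S \<and> t < x}"
  have F: "finite F"
    unfolding F_def by (rule finite.insertI, rule finite_subset[OF _ finite_edge_point_preimage[OF S]]) auto
  have b: "Min F \<in> F" "\<And>x. x \<in> F \<Longrightarrow> Min F \<le> x"
    using F Min_in[OF F] by (auto simp: F_def)
  have "t < Min F"
    using b(1) t by (auto simp: F_def)
  moreover have le: "Min F \<le> L e"
    by (rule b(2)) (simp add: F_def)
  moreover have "edge_point G L e x \<notin> S" if "x \<in> {t<..<Min F}" for x
    using b(2)[of x] that le t by (auto simp: F_def)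
  ultimately have "\<exists>c. \<forall>x\<in>{t..Min F}. f (edge_point G L e x) = f (edge_point G L e t) + c * (x - t)"
    using f [unfolded ohm_def, rule_format, OF e, of t "Min F"] t by simp
  with \<open>t < Min F\<close> le show ?thesis by blast
qed

lemma ohm_affine_left:
  assumes S: "finite S" and f: "ohm G L S f" and e: "e \<in> arcs G" and t: "0 < t" "t \<le> L e"
  shows "\<exists>a c. 0 \<le> a \<and> a < t \<and>
    (\<forall>x\<in>{a..t}. f (edge_point G L e x) = f (edge_point G L e t) + c * (x - t))"
proof -
  define F where "F = insert 0 {x. 0 < x \<and> x < L e \<and> edge_point G L e x \<in> S \<and> x < t}"
  have F: "finite F"
    unfolding F_def by (rule finite.insertI, rule finite_subset[OF _ finite_edge_point_preimage[OF S]]) auto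
  have a: "Max F \<in> F" "\<And>x. x \<in> F \<Longrightarrow> x \<le> Max F"
    using F Max_in[OF F] by (auto simp: F_def)
  have less: "Max F < t"
    using a(1) t by (auto simp: F_def)
  moreover have ge: "0 \<le> Max F"
    by (rule a(2)) (simp add: F_def)
  moreover have "edge_point G L e x \<notin> S" if "x \<in> {Max F<..<t}" for x
    using a(2)[of x] that ge t by (auto simp: F_def)
  ultimately obtain c where
    c: "\<forall>x\<in>{Max F..t}. f (edge_point G L e x) = f (edge_point G L e (Max F)) + c * (x - Max F)"
    using f [unfolded ohm_def, rule_format, OF e, of "Max F" t] t by auto
  have "f (edge_point G L e x) = f (edge_point G L e t) + c * (x - t)" if "x \<in> {Max F..t}" for x
    using bspec[OF c that] bspec[OF c, of t] less by (simp add: algebra_simps)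
  then show ?thesis using less ge by blast
qed

lemma ohm_right_slope:
  assumes "finite S" "ohm G L S f" "e \<in> arcs G" "0 \<le> t" "t < L e"
  obtains c where "((\<lambda>t. f (edge_point G L e t)) has_vector_derivative c) (at_right t)"
proof -
  obtain b c where b: "t < b" and eq: "\<forall>x\<in>{t..b}. f (edge_point G L e x) = f (edge_point G L e t) + c * (x - t)"
    using ohm_affine_right[OF assms] by (elim exE conjE) (rule that)
  show ?thesis
    by (rule that, rule at_right_slope_if_affine[OF b bspec[OF eq]])
qed

lemma ohm_left_slope:
  assumes "finite S" "ohm G L S f" "e \<in> arcs G" "0 < t" "t \<le> L e"
  obtains c where "((\<lambda>t. f (edge_point G L e t)) has_vector_derivative c) (at_left t)"
proof -
  obtain a c where a: "a < t" and eq: "\<forall>x\<in>{a..t}. f (edge_point G L e x) = f (edge_point G L e t) + c * (x - t)"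
    using ohm_affine_left[OF assms] by (elim exE conjE) (rule that)
  show ?thesis
    by (rule that, rule at_left_slope_if_affine[OF a bspec[OF eq]])
qed

section \<open>Harmonic functions and uniqueness of potentials\<close>

context metrized_graph
begin

text \<open>\<open>vector_derivative\<close> respects differences only where derivatives exist;
  Ohm's law with finitely many exceptional points provides the one-sided ones.\<close>

lemma slope_sum_diff:
  assumes S: "finite S" and f: "ohm G L S f" and h: "ohm G L S h" and x: "x \<in> points G L"
  shows "slope_sum G L (\<lambda>x. f x - h x) x = slope_sum G L f x - slope_sum G L h x"
proof -
  let ?r = "\<lambda>f e t. vector_derivative (\<lambda>t. f (edge_point G L e t)) (at_right t)"
  let ?l = "\<lambda>f e t. vector_derivative (\<lambda>t. f (edge_point G L e t)) (at_left t)"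
  have r: "?r (\<lambda>x. f x - h x) e t = ?r f e t - ?r h e t" if et: "e \<in> arcs G" "0 \<le> t" "t < L e" for e t
  proof -
    obtain c where c: "((\<lambda>t. f (edge_point G L e t)) has_vector_derivative c) (at_right t)"
      by (rule ohm_right_slope[OF S f et])
    obtain d where d: "((\<lambda>t. h (edge_point G L e t)) has_vector_derivative d) (at_right t)"
      by (rule ohm_right_slope[OF S h et])
    show ?thesis
      unfolding vector_derivative_at_right[OF c] vector_derivative_at_right[OF d]
      by (rule vector_derivative_at_right[OF has_vector_derivative_diff[OF c d]])
  qed
  have l: "?l (\<lambda>x. f x - h x) e t = ?l f e t - ?l h e t" if et: "e \<in> arcs G" "0 < t" "t \<le> L e" for e t
  proof -
    obtain c where c: "((\<lambda>t. f (edge_point G L e t)) has_vector_derivative c) (at_left t)"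
      by (rule ohm_left_slope[OF S f et])
    obtain d where d: "((\<lambda>t. h (edge_point G L e t)) has_vector_derivative d) (at_left t)"
      by (rule ohm_left_slope[OF S h et])
    show ?thesis
      unfolding vector_derivative_at_left[OF c] vector_derivative_at_left[OF d]
      by (rule vector_derivative_at_left[OF has_vector_derivative_diff[OF c d]])
  qed
  show ?thesis
  proof (cases x)
    case (Vertex v)
    have "(\<Sum>e\<in>out_arcs G v. ?r (\<lambda>x. f x - h x) e 0) = (\<Sum>e\<in>out_arcs G v. ?r f e 0 - ?r h e 0)"
      by (intro sum.cong refl r) (auto simp: length_pos)
    moreover have "(\<Sum>e\<in>in_arcs G v. ?l (\<lambda>x. f x - h x) e (L e)) = (\<Sum>e\<in>in_arcs G v. ?l f e (L e) - ?l h e (L e))"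
      by (intro sum.cong refl l) (auto simp: length_pos)
    ultimately show ?thesis
      by (simp add: Vertex sum_subtractf)
  next
    case (Interior e t)
    then have "e \<in> arcs G" "0 < t" "t < L e"
      using x by (auto simp: points_def)
    then show ?thesis
      by (simp add: Interior r l)
  qed
qed

lemma vertex_in_points [simp]: "v \<in> verts G \<Longrightarrow> Vertex v \<in> points G L"
  by (simp add: points_def)

lemma edge_point_in_points [simp]: "e \<in> arcs G \<Longrightarrow> edge_point G L e t \<in> points G L"
  by (auto simp: points_def edge_point_def)

lemma interior_in_points [simp]:
  "Interior e t \<in> points G L \<longleftrightarrow> e \<in> arcs G \<and> 0 < t \<and> t < L e"
  by (auto simp: points_def)

text \<open>Zero slope sum at interior points rules out kinks, even at points of \<open>S\<close>,
  so \<open>f\<close> is affine on whole edges. At the vertices it makes the energy against every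
  indicator vanish, so the vertex values have no energy and are constant.\<close>

lemma harmonic_const:
  assumes S: "finite S" and f: "ohm G L S f"
    and harmonic: "\<And>x. x \<in> points G L \<Longrightarrow> slope_sum G L f x = 0"
    and "x \<in> points G L" "y \<in> points G L"
  shows "f x = f y"
proof -
  let ?f = "\<lambda>v. f (Vertex v)"
  have ends: "f (edge_point G L e 0) = ?f (tail G e)" "f (edge_point G L e (L e)) = ?f (head G e)"
    if "e \<in> arcs G" for e
    using length_pos[OF that] by (simp_all add: edge_point_def)
  have affine: "f (edge_point G L e t) = ?f (tail G e) + arc_diff G ?f e / L e * t"
    if e: "e \<in> arcs G" and t: "t \<in> {0..L e}" for e t
  proof -
    have "\<exists>c. \<forall>t\<in>{0..L e}. f (edge_point G L e t) = f (edge_point G L e 0) + c * t"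
    proof (rule affine_if_locally_affine[of "L e" "\<lambda>t. f (edge_point G L e t)"])
      show "0 < L e" by (rule length_pos[OF e])
      fix t assume "0 < t" "t < L e"
      then show "vector_derivative (\<lambda>t. f (edge_point G L e t)) (at_right t)
          = vector_derivative (\<lambda>t. f (edge_point G L e t)) (at_left t)"
        using harmonic[of "Interior e t"] e by simp
    qed (use ohm_affine_right[OF S f e] ohm_affine_left[OF S f e] in auto)
    then obtain c where c: "\<forall>t\<in>{0..L e}. f (edge_point G L e t) = ?f (tail G e) + c * t"
      unfolding ends[OF e] ..
    have "c = arc_diff G ?f e / L e"
      using bspec[OF c, of "L e"] ends[OF e] length_pos[OF e] by (simp add: field_simps)
    with bspec[OF c t] show ?thesis by simp
  qed
  have right: "vector_derivative (\<lambda>t. f (edge_point G L e t)) (at_right 0) = arc_diff G ?f e / L e"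
    and left: "vector_derivative (\<lambda>t. f (edge_point G L e t)) (at_left (L e)) = arc_diff G ?f e / L e"
    if e: "e \<in> arcs G" for e
  proof -
    note [simp] = ends[OF e] length_pos[OF e] length_pos[OF e, THEN less_imp_neq, symmetric]
    show "vector_derivative (\<lambda>t. f (edge_point G L e t)) (at_right 0) = arc_diff G ?f e / L e"
      by (rule vector_derivative_at_right, rule at_right_slope_if_affine[of _ "L e"]) (simp_all add: affine[OF e])
    show "vector_derivative (\<lambda>t. f (edge_point G L e t)) (at_left (L e)) = arc_diff G ?f e / L e"
      by (rule vector_derivative_at_left, rule at_left_slope_if_affine[of 0])
        (simp_all add: affine[OF e] right_diff_distrib)
  qed
  have "energy G L (\<lambda>x. of_bool (x = v)) ?f = 0" if v: "v \<in> verts G" for v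
  proof -
    have "0 = (\<Sum>e\<in>out_arcs G v. arc_diff G ?f e / L e) - (\<Sum>e\<in>in_arcs G v. arc_diff G ?f e / L e)"
      using harmonic[of "Vertex v"] v by (simp add: right left)
    then show ?thesis
      by (simp add: energy_delta)
  qed
  then have energy: "energy G L ?f ?f \<le> 0"
    by (subst energy_expand_left) simp
  then have const: "?f u = ?f v" if "u \<in> verts G" "v \<in> verts G" for u v
    using energy_nonpos_imp_const that by blast
  have "\<exists>v\<in>verts G. f x = ?f v" if "x \<in> points G L" for x
  proof (cases x)
    case (Vertex v)
    then show ?thesis using that by (auto simp: points_def)
  next
    case (Interior e t)
    then have *: "e \<in> arcs G" "0 < t" "t < L e" using that by auto
    then have "f x = ?f (tail G e) + arc_diff G ?f e / L e * t"
      using affine[of e t] by (simp add: Interior edge_point_def)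
    also have "arc_diff G ?f e = 0"
      using const[of "head G e" "tail G e"] *(1) by simp
    finally show ?thesis using *(1) by auto
  qed
  then show ?thesis
    using const assms(4,5) by metis
qed

text \<open>Two potentials with the same poles differ by a harmonic function, which is constant, and
  both vanish at \<open>z\<close>. Hence the definite description is well defined.\<close>

lemma voltage_eqI:
  assumes f: "unit_current_potential G L y z f" and x: "x \<in> points G L" and z: "z \<in> points G L"
  shows "voltage G L z x y = f x"
  unfolding voltage_def
proof (rule the_equality)
  show "\<exists>f'. unit_current_potential G L y z f' \<and> f' x = f x"
    by (intro exI[of _ f] conjI f refl)
  fix u assume "\<exists>h. unit_current_potential G L y z h \<and> h x = u"
  then obtain h where h: "unit_current_potential G L y z h" "h x = u"
    by blast
  have ohm: "ohm G L {y, z} f" "ohm G L {y, z} h"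
    using f h by (simp_all add: unit_current_potential_iff_ohm)
  have "f x - h x = f z - h z"
  proof (rule harmonic_const[of "{y, z}" "\<lambda>x. f x - h x"])
    show "slope_sum G L (\<lambda>x. f x - h x) w = 0" if "w \<in> points G L" for w
    proof -
      have "- slope_sum G L f w = - slope_sum G L h w"
        using f h that by (simp add: unit_current_potential_iff_ohm)
      then show ?thesis
        by (simp add: slope_sum_diff[OF _ ohm that])
    qed
  qed (simp_all add: ohm ohm_diff x z)
  then show "u = f x"
    using f h by (simp add: unit_current_potential_iff_ohm)
qed

end

section \<open>The Green kernel on points\<close>

primrec interp ::
    "('v, 'e) pre_digraph \<Rightarrow> ('e \<Rightarrow> real) \<Rightarrow> ('v \<Rightarrow> real) \<Rightarrow> ('v, 'e) point \<Rightarrow> real" where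
  "interp G L f (Vertex v) = f v"
| "interp G L f (Interior e t) = f (tail G e) + arc_diff G f e * t / L e"

text \<open>The Green function, with pole \<open>y\<close>, of an edge whose two ends are grounded.\<close>

definition hat :: "('e \<Rightarrow> real) \<Rightarrow> ('v, 'e) point \<Rightarrow> 'e \<Rightarrow> real \<Rightarrow> real" where
  "hat L y e t = (case y of Vertex v \<Rightarrow> 0 | Interior e' s \<Rightarrow> if e' = e then min t s - t * s / L e else 0)"

text \<open>The slopes of \<open>hat\<close> to the right and to the left; strict against weak
  comparison makes them differ exactly at the pole, by one.\<close>

definition hat_right :: "('e \<Rightarrow> real) \<Rightarrow> ('v, 'e) point \<Rightarrow> 'e \<Rightarrow> real \<Rightarrow> real" where
  "hat_right L y e t =
     (case y of Vertex v \<Rightarrow> 0 | Interior e' s \<Rightarrow> if e' = e then of_bool (t < s) - s / L e else 0)"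

definition hat_left :: "('e \<Rightarrow> real) \<Rightarrow> ('v, 'e) point \<Rightarrow> 'e \<Rightarrow> real \<Rightarrow> real" where
  "hat_left L y e t =
     (case y of Vertex v \<Rightarrow> 0 | Interior e' s \<Rightarrow> if e' = e then of_bool (t \<le> s) - s / L e else 0)"

definition bubble :: "('e \<Rightarrow> real) \<Rightarrow> ('v, 'e) point \<Rightarrow> ('v, 'e) point \<Rightarrow> real" where
  "bubble L x y = (case x of Vertex v \<Rightarrow> 0 | Interior e t \<Rightarrow> hat L y e t)"

lemma hat_affine:
  assumes "\<And>s. y = Interior e s \<Longrightarrow> s \<le> a \<or> b \<le> s"
  shows "\<exists>c. \<forall>t\<in>{a..b}. hat L y e t = hat L y e a + c * (t - a)"
proof (cases "\<exists>s. y = Interior e s")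
  case True
  then obtain s where y: "y = Interior e s" by blast
  show ?thesis
  proof (cases "s \<le> a")
    case True
    then have "\<forall>t\<in>{a..b}. hat L y e t = hat L y e a + (- s / L e) * (t - a)"
      by (auto simp: y hat_def algebra_simps diff_divide_distrib)
    then show ?thesis ..
  next
    case False
    then have "b \<le> s" using assms[OF y] by simp
    then have "\<forall>t\<in>{a..b}. hat L y e t = hat L y e a + (1 - s / L e) * (t - a)"
      by (auto simp: y hat_def algebra_simps diff_divide_distrib)
    then show ?thesis ..
  qed
next
  case False
  then have "hat L y e t = 0" for t
    by (auto simp: hat_def split: point.splits)
  then show ?thesis by (intro exI[of _ 0]) simp
qed

lemma hat_has_right_slope: "(hat L y e has_vector_derivative hat_right L y e t) (at_right t)"
proof (cases "\<exists>s. y = Interior e s")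
  case True
  then obtain s where y: "y = Interior e s" by blast
  show ?thesis
    \<comment> \<open>\<open>hat\<close> is affine up to its pole; beyond the pole any right end
      serves.\<close>
    by (rule at_right_slope_if_affine[of t "if t < s then s else t + 1"])
       (auto simp: y hat_def hat_right_def algebra_simps diff_divide_distrib split: if_splits)
next
  case False
  then have "hat L y e = (\<lambda>t. 0)" "hat_right L y e t = 0"
    by (auto simp: hat_def hat_right_def split: point.splits)
  then show ?thesis by simp
qed

lemma hat_has_left_slope: "(hat L y e has_vector_derivative hat_left L y e t) (at_left t)"
proof (cases "\<exists>s. y = Interior e s")
  case True
  then obtain s where y: "y = Interior e s" by blast
  show ?thesis
    by (rule at_left_slope_if_affine[of "if t \<le> s then t - 1 else s"])
       (auto simp: y hat_def hat_left_def algebra_simps diff_divide_distrib split: if_splits)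
next
  case False
  then have "hat L y e = (\<lambda>t. 0)" "hat_left L y e t = 0"
    by (auto simp: hat_def hat_left_def split: point.splits)
  then show ?thesis by simp
qed

context metrized_graph
begin

lemma interp_edge_point:
  assumes "e \<in> arcs G" "0 \<le> t" "t \<le> L e"
  shows "interp G L f (edge_point G L e t) = f (tail G e) + arc_diff G f e * t / L e"
  using assms length_pos[OF assms(1)] by (auto simp: edge_point_def)

lemma bubble_edge_point:
  assumes "y \<in> points G L" "e \<in> arcs G" "0 \<le> t" "t \<le> L e"
  shows "bubble L (edge_point G L e t) y = hat L y e t"
  using assms length_pos[OF assms(2)]
  by (auto simp: edge_point_def bubble_def hat_def split: point.splits)

end

context grounded_graph
begin

text \<open>By symmetry of \<open>g\<close>, the potential at the vertex \<open>u\<close> of a unit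
  current injected at \<open>y\<close>. If \<open>y\<close> lies at distance t along
  \<open>e\<close>, the vertices see it as currents 1 - t/L at the tail and t/L at the head, as
  \<open>energy_spread\<close> records.\<close>

definition spread :: "('v, 'e) point \<Rightarrow> 'v \<Rightarrow> real" where
  "spread y u = interp G L (g u) y"

definition green_kernel :: "('v, 'e) point \<Rightarrow> ('v, 'e) point \<Rightarrow> real" where
  "green_kernel x y = interp G L (spread y) x + bubble L x y"

lemma kernel_edge_point:
  assumes "y \<in> points G L" "e \<in> arcs G" "0 \<le> t" "t \<le> L e"
  shows "green_kernel (edge_point G L e t) y
    = spread y (tail G e) + arc_diff G (spread y) e * t / L e + hat L y e t"
  using assms by (simp add: green_kernel_def interp_edge_point bubble_edge_point)

lemma energy_spread:
  assumes "y \<in> points G L"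
  shows "energy G L h (spread y) = interp G L h y - h ground"
proof (cases y)
  case (Vertex v)
  then have v: "v \<in> verts G" using assms by (auto simp: points_def)
  have "energy G L h (spread y) = energy G L h (g v)"
    by (rule energy_cong) (simp_all add: spread_def Vertex green_sym v)
  then show ?thesis by (simp add: green v Vertex)
next
  case (Interior e t)
  then have e: "e \<in> arcs G" using assms by simp
  have "energy G L h (spread y)
      = energy G L h (\<lambda>u. g (tail G e) u + t / L e * (g (head G e) u - g (tail G e) u))"
    by (rule energy_cong)
       (simp_all add: spread_def Interior green_sym[of _ "tail G e"] green_sym[of _ "head G e"] e)
  also have "\<dots> = h (tail G e) - h ground + t / L e * arc_diff G h e"
    by (simp only: energy_add energy_scale energy_diff green e head_in_verts tail_in_verts)
      (simp add: algebra_simps)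
  finally show ?thesis by (simp add: Interior mult_ac)
qed

text \<open>The other pole, the ground, is a vertex and thus never interior to a segment; only the
  kink of \<open>hat\<close> at \<open>y\<close> must be avoided.\<close>

lemma ohm_kernel:
  assumes y: "y \<in> points G L"
  shows "ohm G L {y} (\<lambda>x. green_kernel x y)"
  unfolding ohm_def
proof (intro ballI allI impI)
  fix e a b
  assume e: "e \<in> arcs G" and ab: "0 \<le> a" "a \<le> b" "b \<le> L e"
    and avoid: "\<forall>t\<in>{a<..<b}. edge_point G L e t \<notin> {y}"
  have "\<exists>c. \<forall>t\<in>{a..b}. hat L y e t = hat L y e a + c * (t - a)"
  proof (rule hat_affine)
    fix s assume s: "y = Interior e s"
    show "s \<le> a \<or> b \<le> s"
    proof (rule ccontr)
      assume "\<not> (s \<le> a \<or> b \<le> s)"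
      then have "s \<in> {a<..<b}" by auto
      then have "edge_point G L e s \<noteq> y" using avoid by auto
      then show False
        using s y by (simp add: edge_point_def)
    qed
  qed
  then obtain c where c: "\<forall>t\<in>{a..b}. hat L y e t = hat L y e a + c * (t - a)" ..
  show "\<exists>c. \<forall>t\<in>{a..b}. green_kernel (edge_point G L e t) y = green_kernel (edge_point G L e a) y + c * (t - a)"
  proof (intro exI[of _ "arc_diff G (spread y) e / L e + c"] ballI)
    fix t assume t: "t \<in> {a..b}"
    have "green_kernel (edge_point G L e t) y
        = spread y (tail G e) + arc_diff G (spread y) e * t / L e + hat L y e t"
      "green_kernel (edge_point G L e a) y
        = spread y (tail G e) + arc_diff G (spread y) e * a / L e + hat L y e a"
      using t ab by (auto intro!: kernel_edge_point[OF y e])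
    with bspec[OF c t]
    show "green_kernel (edge_point G L e t) y
        = green_kernel (edge_point G L e a) y + (arc_diff G (spread y) e / L e + c) * (t - a)"
      by (simp add: algebra_simps diff_divide_distrib)
  qed
qed

lemma kernel_right_slope:
  assumes y: "y \<in> points G L" and e: "e \<in> arcs G" and t: "0 \<le> t" "t < L e"
  shows "vector_derivative (\<lambda>t. green_kernel (edge_point G L e t) y) (at_right t)
    = arc_diff G (spread y) e / L e + hat_right L y e t"
proof -
  have "((\<lambda>t. spread y (tail G e) + arc_diff G (spread y) e / L e * t + hat L y e t)
      has_vector_derivative arc_diff G (spread y) e / L e + hat_right L y e t) (at_right t)"
    using length_pos[OF e] by (intro has_vector_derivative_add hat_has_right_slope)
       (auto intro!: derivative_eq_intros simp: has_real_derivative_iff_has_vector_derivative [symmetric])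
  \<comment> \<open>The formula for the kernel holds only along the edge, so the filter is rewritten
    with an interval that stays inside it.\<close>
  then have "((\<lambda>t. spread y (tail G e) + arc_diff G (spread y) e / L e * t + hat L y e t)
      has_vector_derivative arc_diff G (spread y) e / L e + hat_right L y e t) (at t within {t..L e})"
    using t by (simp add: at_within_Icc_at_right)
  then have "((\<lambda>t. green_kernel (edge_point G L e t) y)
      has_vector_derivative arc_diff G (spread y) e / L e + hat_right L y e t) (at t within {t..L e})"
    by (rule has_vector_derivative_transform [rotated 2]) (use t in \<open>auto simp: kernel_edge_point[OF y e]\<close>)
  then show ?thesis
    using t by (simp add: at_within_Icc_at_right vector_derivative_at_right)
qed

lemma kernel_left_slope:
  assumes y: "y \<in> points G L" and e: "e \<in> arcs G" and t: "0 < t" "t \<le> L e"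
  shows "vector_derivative (\<lambda>t. green_kernel (edge_point G L e t) y) (at_left t)
    = arc_diff G (spread y) e / L e + hat_left L y e t"
proof -
  have "((\<lambda>t. spread y (tail G e) + arc_diff G (spread y) e / L e * t + hat L y e t)
      has_vector_derivative arc_diff G (spread y) e / L e + hat_left L y e t) (at_left t)"
    using length_pos[OF e] by (intro has_vector_derivative_add hat_has_left_slope)
       (auto intro!: derivative_eq_intros simp: has_real_derivative_iff_has_vector_derivative [symmetric])
  then have "((\<lambda>t. spread y (tail G e) + arc_diff G (spread y) e / L e * t + hat L y e t)
      has_vector_derivative arc_diff G (spread y) e / L e + hat_left L y e t) (at t within {0..t})"
    using t by (simp add: at_within_Icc_at_left)
  then have "((\<lambda>t. green_kernel (edge_point G L e t) y)
      has_vector_derivative arc_diff G (spread y) e / L e + hat_left L y e t) (at t within {0..t})"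
    by (rule has_vector_derivative_transform [rotated 2]) (use t in \<open>auto simp: kernel_edge_point[OF y e]\<close>)
  then show ?thesis
    using t by (simp add: at_within_Icc_at_left vector_derivative_at_left)
qed

text \<open>Inside an edge only the kink of \<open>hat\<close> counts. At a vertex,
  \<open>energy_spread\<close> gives the ground term and the weights with which \<open>y\<close> is
  split among its edge's ends; for interior \<open>y\<close> these weights cancel against the end
  slopes of \<open>hat\<close>.\<close>

lemma slope_sum_kernel:
  assumes y: "y \<in> points G L" and x: "x \<in> points G L"
  shows "slope_sum G L (\<lambda>x. green_kernel x y) x = of_bool (x = Vertex ground) - of_bool (x = y)"
proof (cases x)
  case (Interior e t)
  then have e: "e \<in> arcs G" "0 < t" "t < L e" using x by auto
  have "slope_sum G L (\<lambda>x. green_kernel x y) x = hat_right L y e t - hat_left L y e t"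
    using e by (simp add: Interior kernel_right_slope[OF y] kernel_left_slope[OF y])
  also have "\<dots> = - of_bool (x = y)"
    by (auto simp: Interior hat_right_def hat_left_def split: point.splits)
  finally show ?thesis by (simp add: Interior)
next
  case (Vertex v)
  let ?\<delta> = "\<lambda>x. of_bool (x = v) :: real"
  have "slope_sum G L (\<lambda>x. green_kernel x y) x
      = (\<Sum>e\<in>out_arcs G v. arc_diff G (spread y) e / L e + hat_right L y e 0)
        - (\<Sum>e\<in>in_arcs G v. arc_diff G (spread y) e / L e + hat_left L y e (L e))"
    unfolding Vertex slope_sum.simps
    by (intro arg_cong2[where f = "(-)"] sum.cong refl kernel_right_slope[OF y] kernel_left_slope[OF y])
       (auto simp: length_pos less_imp_le)
  also have "\<dots> = - energy G L ?\<delta> (spread y)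
      + ((\<Sum>e\<in>out_arcs G v. hat_right L y e 0) - (\<Sum>e\<in>in_arcs G v. hat_left L y e (L e)))"
    by (simp add: energy_delta sum.distrib)
  also have "\<dots> = of_bool (x = Vertex ground) - of_bool (x = y)"
  proof (cases y)
    case y: (Vertex w)
    then show ?thesis
      using assms by (auto simp: energy_spread Vertex hat_right_def hat_left_def)
  next
    case y': (Interior e s)
    then have e: "e \<in> arcs G" "0 < s" "s < L e" using y by auto
    have "(\<Sum>k\<in>out_arcs G v. hat_right L y k 0)
        = (\<Sum>k\<in>out_arcs G v. if k = e then 1 - s / L e else 0)"
      by (intro sum.cong refl) (use e y' in \<open>auto simp: hat_right_def\<close>)
    also have "\<dots> = of_bool (tail G e = v) * (1 - s / L e)"
      using e by (simp add: out_arcs_def)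
    finally have out: "(\<Sum>k\<in>out_arcs G v. hat_right L y k 0) = \<dots>" .
    have "(\<Sum>k\<in>in_arcs G v. hat_left L y k (L k))
        = (\<Sum>k\<in>in_arcs G v. if k = e then - s / L e else 0)"
      by (intro sum.cong refl) (use e y' in \<open>auto simp: hat_left_def\<close>)
    also have "\<dots> = - (of_bool (head G e = v) * s / L e)"
      using e by (simp add: in_arcs_def)
    finally have "in": "(\<Sum>k\<in>in_arcs G v. hat_left L y k (L k)) = \<dots>" .
    show ?thesis
      unfolding out "in" energy_spread[OF y]
      by (auto simp: y' Vertex algebra_simps diff_divide_distrib)
  qed
  finally show ?thesis .
qed

text \<open>In the difference of the kernels with poles \<open>y\<close> and \<open>z\<close> the
  currents leaving at the ground cancel; the subtracted constant moves the zero to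
  \<open>z\<close>.\<close>

lemma voltage_eq_kernel:
  assumes x: "x \<in> points G L" and y: "y \<in> points G L" and z: "z \<in> points G L"
  shows "voltage G L z x y = green_kernel x y - green_kernel x z - (green_kernel z y - green_kernel z z)"
proof (rule voltage_eqI[OF _ x z])
  have K: "ohm G L {y, z} (\<lambda>x. green_kernel x y)" "ohm G L {y, z} (\<lambda>x. green_kernel x z)"
    by (auto intro: ohm_mono[OF ohm_kernel] y z)
  show "unit_current_potential G L y z (\<lambda>x. green_kernel x y - green_kernel x z - (green_kernel z y - green_kernel z z))"
    unfolding unit_current_potential_iff_ohm
  proof (intro conjI ballI)
    show "ohm G L {y, z} (\<lambda>x. green_kernel x y - green_kernel x z - (green_kernel z y - green_kernel z z))"
      by (intro ohm_diff ohm_const K)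
    fix w assume w: "w \<in> points G L"
    have "slope_sum G L (\<lambda>x. green_kernel x y - green_kernel x z - (green_kernel z y - green_kernel z z)) w
        = slope_sum G L (\<lambda>x. green_kernel x y) w - slope_sum G L (\<lambda>x. green_kernel x z) w
          - slope_sum G L (\<lambda>x. green_kernel z y - green_kernel z z) w"
      by (subst slope_sum_diff[where S = "{y, z}"])
         (simp_all only: ohm_diff ohm_const K w finite.intros slope_sum_diff[where S = "{y, z}"])
    also have "slope_sum G L (\<lambda>x. green_kernel z y - green_kernel z z) w = 0"
      by (cases w) (simp_all add: vector_derivative_at_right [OF has_vector_derivative_const]
          vector_derivative_at_left [OF has_vector_derivative_const])
    finally show "- slope_sum G L (\<lambda>x. green_kernel x y - green_kernel x z - (green_kernel z y - green_kernel z z)) w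
        = of_bool (w = y) - of_bool (w = z)"
      using w y z by (simp add: slope_sum_kernel)
  qed simp
qed

end

section \<open>The tau constant and the constants \<open>A\<close>\<close>

lemma has_integral_square_affine:
  fixes u v l \<alpha> \<beta> :: real
  defines "P \<equiv> \<lambda>t. \<alpha>\<^sup>2 * t + 2 * \<alpha> * \<beta> * (t - t\<^sup>2 / l) + \<beta>\<^sup>2 * (t - 2 * t\<^sup>2 / l + 4 * t ^ 3 / (3 * l\<^sup>2))"
  assumes "u \<le> v" "l \<noteq> 0"
  shows "((\<lambda>t. (\<alpha> + \<beta> * (1 - 2 * t / l))\<^sup>2) has_integral (P v - P u)) {u..v}"
proof (rule fundamental_theorem_of_calculus[OF assms(2)])
  fix t
  show "(P has_vector_derivative (\<alpha> + \<beta> * (1 - 2 * t / l))\<^sup>2) (at t within {u..v})"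
    unfolding P_def has_real_derivative_iff_has_vector_derivative [symmetric]
    using assms(3) by (auto intro!: derivative_eq_intros simp: power2_eq_square field_simps)
qed

lemma has_integral_bump:
  fixes l \<alpha> \<beta> \<kappa> :: real
  assumes "0 < l"
  shows "((\<lambda>t. \<alpha> + \<beta> * t + \<kappa> * (t - t\<^sup>2 / l)) has_integral (\<alpha> * l + \<beta> * l\<^sup>2 / 2 + \<kappa> * l\<^sup>2 / 6)) {0..l}"
proof -
  let ?P = "\<lambda>t. \<alpha> * t + \<beta> * t\<^sup>2 / 2 + \<kappa> * (t\<^sup>2 / 2 - t ^ 3 / (3 * l))"
  have "((\<lambda>t. \<alpha> + \<beta> * t + \<kappa> * (t - t\<^sup>2 / l)) has_integral (?P l - ?P 0)) {0..l}"
  proof (rule fundamental_theorem_of_calculus)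
    fix t
    show "(?P has_vector_derivative (\<alpha> + \<beta> * t + \<kappa> * (t - t\<^sup>2 / l))) (at t within {0..l})"
      unfolding has_real_derivative_iff_has_vector_derivative [symmetric]
      using assms by (auto intro!: derivative_eq_intros simp: power2_eq_square field_simps)
  qed (use assms in simp)
  moreover have "?P l - ?P 0 = \<alpha> * l + \<beta> * l\<^sup>2 / 2 + \<kappa> * l\<^sup>2 / 6"
    using assms by (simp add: power2_eq_square power3_eq_cube field_simps)
  ultimately show ?thesis by (simp only:)
qed

lemma hat_has_derivative:
  assumes "y \<noteq> Interior e t"
  shows "(hat L y e has_real_derivative hat_right L y e t) (at t)"
proof (cases "\<exists>s. y = Interior e s")
  case True
  then obtain s where y: "y = Interior e s" by blast
  then have "t \<noteq> s" using assms by auto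
  define c where "c = s / L e"
  show ?thesis
  proof (cases "t < s")
    case True
    show ?thesis
    proof (rule has_field_derivative_transform_within_open[of "\<lambda>t. t - t * c" _ _ "{..<s}"])
      have "((\<lambda>t. t - t * c) has_real_derivative 1 - c) (at t)"
        by (auto intro!: derivative_eq_intros)
      then show "((\<lambda>t. t - t * c) has_real_derivative hat_right L y e t) (at t)"
        using True by (simp add: y hat_right_def c_def)
    qed (use True in \<open>auto simp: y hat_def c_def\<close>)
  next
    case False
    then have "s < t" using \<open>t \<noteq> s\<close> by simp
    show ?thesis
    proof (rule has_field_derivative_transform_within_open[of "\<lambda>t. s - t * c" _ _ "{s<..}"])
      have "((\<lambda>t. s - t * c) has_real_derivative - c) (at t)"
        by (auto intro!: derivative_eq_intros)
      then show "((\<lambda>t. s - t * c) has_real_derivative hat_right L y e t) (at t)"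
        using False by (simp add: y hat_right_def c_def)
    qed (use \<open>s < t\<close> in \<open>auto simp: y hat_def c_def\<close>)
  qed
next
  case False
  then have "hat L y e = (\<lambda>t. 0)" "hat_right L y e t = 0"
    by (auto simp: hat_def hat_right_def split: point.splits)
  then show ?thesis by simp
qed

lemma arc_deriv_edge_point:
  assumes "0 < t" "t < L e" and "(f has_real_derivative D) (at t)"
    and "\<And>t. 0 < t \<Longrightarrow> t < L e \<Longrightarrow> F (edge_point G L e t) = f t"
  shows "arc_deriv G L F (edge_point G L e t) = D"
proof -
  have "((\<lambda>t. F (edge_point G L e t)) has_real_derivative D) (at t)"
    by (rule has_field_derivative_transform_within_open[OF assms(3), of "{0<..<L e}"])
       (use assms in auto)
  then show ?thesis
    using assms(1,2) by (simp add: edge_point_def DERIV_imp_deriv)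
qed

section \<open>Resistance, tau and A through the Green function\<close>

context grounded_graph
begin

lemma green_kernel_commute:
  assumes "x \<in> points G L" "y \<in> points G L"
  shows "green_kernel x y = green_kernel y x"
proof -
  have "bubble L x y = bubble L y x"
    by (auto simp: bubble_def hat_def min.commute split: point.splits)
  moreover have "interp G L (spread y) x = interp G L (spread x) y"
  proof -
    have "g u v = g v u" if "u \<in> verts G" "v \<in> verts G" for u v
      using that by (rule green_sym)
    then show ?thesis
      using assms
      by (cases x; cases y)
         (auto simp: points_def spread_def algebra_simps add_divide_distrib diff_divide_distrib)
  qed
  ultimately show ?thesis
    by (simp add: green_kernel_def)
qed

lemma green_kernel_vertex: "green_kernel (Vertex u) (Vertex v) = g u v"
  by (simp add: green_kernel_def spread_def bubble_def)

text \<open>On the diagonal the bilinear interpolation contributes \<open>- edge_res e / L e\<close>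
  times the bump \<open>t - t\<^sup>2 / L e\<close>, and the bubble contributes the bump
  itself.\<close>

lemma green_kernel_diagonal:
  assumes e: "e \<in> arcs G" and t: "0 < t" "t < L e"
  shows "green_kernel (edge_point G L e t) (edge_point G L e t)
    = g (tail G e) (tail G e) + arc_diff G (\<lambda>v. g v v) e / L e * t + (1 - edge_res e / L e) * (t - t\<^sup>2 / L e)"
  using t length_pos[OF e]
  by (simp add: green_kernel_def edge_point_def spread_def bubble_def hat_def edge_res_eq[OF e]
      green_sym[of "head G e" "tail G e"] e power2_eq_square field_simps)

lemma eff_resistance_eq_green_kernel:
  assumes "x \<in> points G L" "y \<in> points G L"
  shows "eff_resistance G L x y = green_kernel x x - 2 * green_kernel x y + green_kernel y y"
  using assms by (simp add: eff_resistance_def voltage_eq_kernel green_kernel_commute[of y x])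

lemma arc_deriv_eff_resistance:
  assumes y: "y \<in> points G L" and e: "e \<in> arcs G" and t: "0 < t" "t < L e" and ne: "y \<noteq> Interior e t"
  shows "arc_deriv G L (\<lambda>w. eff_resistance G L w y) (edge_point G L e t)
    = arc_diff G (\<lambda>v. g v v - 2 * spread y v) e / L e - 2 * hat_right L y e t
      + (1 - edge_res e / L e) * (1 - 2 * t / L e)"
proof (rule arc_deriv_edge_point[where L = L and e = e, OF t])
  let ?r = "\<lambda>t. (g (tail G e) (tail G e) - 2 * spread y (tail G e) + green_kernel y y)
      + arc_diff G (\<lambda>v. g v v - 2 * spread y v) e / L e * t
      + (1 - edge_res e / L e) * (t - t\<^sup>2 / L e) - 2 * hat L y e t"
  show "(?r has_real_derivative arc_diff G (\<lambda>v. g v v - 2 * spread y v) e / L e - 2 * hat_right L y e t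
      + (1 - edge_res e / L e) * (1 - 2 * t / L e)) (at t)"
    using length_pos[OF e] by (auto intro!: derivative_eq_intros hat_has_derivative[OF ne])
  fix t assume t: "0 < t" "t < L e"
  then show "eff_resistance G L (edge_point G L e t) y = ?r t"
    by (simp add: eff_resistance_eq_green_kernel[OF edge_point_in_points[OF e] y]
        green_kernel_diagonal[OF e t] kernel_edge_point[OF y e] field_simps)
qed

text \<open>The contribution of the kink of \<open>r(x, y)\<close> at \<open>x = y\<close> when \<open>y\<close> is interior to \<open>e\<close>; it cancels in
  \<open>\<tau>\<close>, which makes \<open>\<tau>\<close> independent of \<open>y\<close>.\<close>

definition kink_term :: "('v, 'e) point \<Rightarrow> 'e \<Rightarrow> real" where
  "kink_term y e = (case y of Vertex v \<Rightarrow> 0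
     | Interior e' s \<Rightarrow> if e' = e then 4 * (s / L e) * (1 - s / L e) * edge_res e else 0)"

lemma integral_arc_deriv_eff_resistance:
  assumes y: "y \<in> points G L" and e: "e \<in> arcs G"
  shows "integral {0..L e} (\<lambda>t. (arc_deriv G L (\<lambda>w. eff_resistance G L w y) (edge_point G L e t))\<^sup>2)
    = (arc_diff G (\<lambda>v. g v v - 2 * spread y v) e)\<^sup>2 / L e + L e / 3 * (1 - edge_res e / L e)\<^sup>2
      + kink_term y e"
proof -
  define B where "B = arc_diff G (\<lambda>v. g v v - 2 * spread y v) e"
  define \<beta> where "\<beta> = 1 - edge_res e / L e"
  have L: "0 < L e" by (rule length_pos[OF e])
  have deriv: "arc_deriv G L (\<lambda>w. eff_resistance G L w y) (edge_point G L e t)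
      = (B / L e - 2 * hat_right L y e t) + \<beta> * (1 - 2 * t / L e)"
    if "0 < t" "t < L e" "y \<noteq> Interior e t" for t
    using arc_deriv_eff_resistance[OF y e that] by (simp add: B_def \<beta>_def)
  show ?thesis
  proof (cases "\<exists>s. y = Interior e s")
    case False
    have hat: "hat_right L y e t = 0" for t
      using False by (auto simp: hat_right_def split: point.splits)
    have "((\<lambda>t. (arc_deriv G L (\<lambda>w. eff_resistance G L w y) (edge_point G L e t))\<^sup>2)
        has_integral (B\<^sup>2 / L e + \<beta>\<^sup>2 * (L e / 3))) {0..L e}"
    proof (rule has_integral_spike_finite[of "{0, L e}"])
      show "((\<lambda>t. (B / L e + \<beta> * (1 - 2 * t / L e))\<^sup>2) has_integral (B\<^sup>2 / L e + \<beta>\<^sup>2 * (L e / 3))) {0..L e}"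
        using has_integral_square_affine[of 0 "L e" "L e" "B / L e" \<beta>] L
        by (simp add: power2_eq_square power3_eq_cube field_simps)
      fix t assume "t \<in> {0..L e} - {0, L e}"
      then show "(arc_deriv G L (\<lambda>w. eff_resistance G L w y) (edge_point G L e t))\<^sup>2
          = (B / L e + \<beta> * (1 - 2 * t / L e))\<^sup>2"
        using deriv[of t] hat[of t] False by auto
    qed simp
    moreover have "kink_term y e = 0"
      using False by (auto simp: kink_term_def split: point.splits)
    ultimately show ?thesis
      by (simp add: integral_unique B_def \<beta>_def mult.commute)
  next
    case True
    then obtain s where s: "y = Interior e s" by blast
    then have s01: "0 < s" "s < L e" using y by auto
    define P where "P \<alpha> t = \<alpha>\<^sup>2 * t + 2 * \<alpha> * \<beta> * (t - t\<^sup>2 / L e)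
        + \<beta>\<^sup>2 * (t - 2 * t\<^sup>2 / L e + 4 * t ^ 3 / (3 * (L e)\<^sup>2))" for \<alpha> t
    \<comment> \<open>The constant parts of the derivative before and after the pole, where
      \<open>hat_right\<close> is \<open>1 - s / L e\<close> and \<open>- s / L e\<close>.\<close>
    define \<alpha>1 \<alpha>2 where "\<alpha>1 = B / L e - 2 * (1 - s / L e)" and "\<alpha>2 = B / L e + 2 * s / L e"
    let ?f = "\<lambda>t. (arc_deriv G L (\<lambda>w. eff_resistance G L w y) (edge_point G L e t))\<^sup>2"
    have "(?f has_integral (P \<alpha>1 s - P \<alpha>1 0)) {0..s}"
    proof (rule has_integral_spike_finite[of "{0, s}"])
      show "((\<lambda>t. (\<alpha>1 + \<beta> * (1 - 2 * t / L e))\<^sup>2) has_integral (P \<alpha>1 s - P \<alpha>1 0)) {0..s}"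
        unfolding P_def using s01 by (intro has_integral_square_affine) auto
      fix t assume "t \<in> {0..s} - {0, s}"
      then show "?f t = (\<alpha>1 + \<beta> * (1 - 2 * t / L e))\<^sup>2"
        using deriv[of t] s01 by (simp add: s hat_right_def \<alpha>1_def)
    qed simp
    moreover have "(?f has_integral (P \<alpha>2 (L e) - P \<alpha>2 s)) {s..L e}"
    proof (rule has_integral_spike_finite[of "{s, L e}"])
      show "((\<lambda>t. (\<alpha>2 + \<beta> * (1 - 2 * t / L e))\<^sup>2) has_integral (P \<alpha>2 (L e) - P \<alpha>2 s)) {s..L e}"
        unfolding P_def using s01 by (intro has_integral_square_affine) auto
      fix t assume "t \<in> {s..L e} - {s, L e}"
      then show "?f t = (\<alpha>2 + \<beta> * (1 - 2 * t / L e))\<^sup>2"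
        using deriv[of t] s01 by (simp add: s hat_right_def \<alpha>2_def)
    qed simp
    ultimately have "integral {0..L e} ?f = P \<alpha>1 s - P \<alpha>1 0 + (P \<alpha>2 (L e) - P \<alpha>2 s)"
      using s01 by (intro integral_unique has_integral_combine[of 0 s]) auto
    also have "\<dots> = B\<^sup>2 / L e + L e / 3 * \<beta>\<^sup>2 + kink_term y e"
    proof -
      \<comment> \<open>Lengths are rescaled by \<open>L e\<close>. Since \<open>y\<close> lies on
        \<open>e\<close>, the drop \<open>B\<close> is itself determined by \<sigma> and
        \<mu>.\<close>
      define \<sigma> \<mu> where "\<sigma> = edge_res e / L e" and "\<mu> = s / L e"
      have subst: "edge_res e = \<sigma> * L e" "s = \<mu> * L e" "\<beta> = 1 - \<sigma>"
        using L by (simp_all add: \<sigma>_def \<mu>_def \<beta>_def)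
      have B: "B = (1 - 2 * \<mu>) * \<sigma> * L e"
      proof -
        have "B = (1 - 2 * \<mu>) * edge_res e"
          unfolding B_def edge_res_eq[OF e] \<mu>_def using L
          by (simp add: spread_def s green_sym[of "head G e" "tail G e"] e field_simps)
        then show ?thesis by (simp add: subst)
      qed
      have \<alpha>: "\<alpha>1 = (1 - 2 * \<mu>) * \<sigma> - 2 * (1 - \<mu>)" "\<alpha>2 = (1 - 2 * \<mu>) * \<sigma> + 2 * \<mu>"
        using L by (simp_all add: \<alpha>1_def \<alpha>2_def B \<mu>_def [symmetric])
          (simp_all add: \<mu>_def)
      have kink: "kink_term y e = 4 * \<mu> * (1 - \<mu>) * \<sigma> * L e"
        by (simp add: kink_term_def s \<mu>_def subst(1))
      have P: "P \<alpha> (x * L e) = L e * (\<alpha>\<^sup>2 * x + 2 * \<alpha> * \<beta> * (x - x\<^sup>2) + \<beta>\<^sup>2 * (x - 2 * x\<^sup>2 + 4 * x ^ 3 / 3))" for \<alpha> x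
        using L by (simp add: P_def power2_eq_square power3_eq_cube field_simps)
      have "B\<^sup>2 / L e = L e * ((1 - 2 * \<mu>) * \<sigma>)\<^sup>2"
        using L by (simp add: B power2_eq_square field_simps)
      then show ?thesis
        unfolding kink using P[of \<alpha>1 \<mu>] P[of \<alpha>1 0] P[of \<alpha>2 1] P[of \<alpha>2 \<mu>]
        unfolding subst(2) [symmetric] mult_1 mult_zero_left \<alpha> subst(3)
        by (simp add: power2_eq_square power3_eq_cube field_simps)
    qed
    finally show ?thesis
      by (simp add: B_def \<beta>_def)
  qed
qed

text \<open>Expanding the energy of \<open>g v v - 2 * spread y v\<close>, the part that depends on
  \<open>y\<close> is evaluated by \<open>energy_spread\<close> and equals minus the total of the
  kink terms.\<close>

lemma tau_eq:
  assumes y: "y \<in> points G L"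
  shows "4 * tau G L y = energy G L (\<lambda>v. g v v) (\<lambda>v. g v v) + (\<Sum>e\<in>arcs G. L e / 3 * (1 - edge_res e / L e)\<^sup>2)"
proof -
  let ?\<gamma> = "\<lambda>v. g v v"
  have "4 * tau G L y = (\<Sum>e\<in>arcs G. (arc_diff G (\<lambda>v. g v v - 2 * spread y v) e)\<^sup>2 / L e
      + L e / 3 * (1 - edge_res e / L e)\<^sup>2 + kink_term y e)"
    unfolding tau_def graph_integral_def
    using integral_arc_deriv_eff_resistance[OF y] by simp
  also have "\<dots> = energy G L (\<lambda>v. ?\<gamma> v - 2 * spread y v) (\<lambda>v. ?\<gamma> v - 2 * spread y v)
      + (\<Sum>e\<in>arcs G. L e / 3 * (1 - edge_res e / L e)\<^sup>2) + (\<Sum>e\<in>arcs G. kink_term y e)"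
    by (simp add: sum.distrib energy_def power2_eq_square)
  also have "energy G L (\<lambda>v. ?\<gamma> v - 2 * spread y v) (\<lambda>v. ?\<gamma> v - 2 * spread y v)
      = energy G L ?\<gamma> ?\<gamma> - 4 * (energy G L ?\<gamma> (spread y) - energy G L (spread y) (spread y))"
  proof -
    have *: "energy G L (\<lambda>v. ?\<gamma> v - 2 * spread y v) f = energy G L ?\<gamma> f - 2 * energy G L (spread y) f" for f
      by (simp only: energy_commute[of G L _ f] energy_diff energy_scale)
    show ?thesis
      unfolding energy_diff energy_scale * by (simp add: energy_commute[of G L "spread y" ?\<gamma>])
  qed
  also have "energy G L ?\<gamma> (spread y) - energy G L (spread y) (spread y)
      = interp G L ?\<gamma> y - interp G L (spread y) y"
  proof -
    have "g ground v = 0" if "v \<in> verts G" for v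
      using green_sym[OF ground that] green_ground[OF that] by simp
    then have "spread y ground = 0"
      using y by (cases y) (auto simp: spread_def points_def)
    then show ?thesis
      by (simp add: energy_spread[OF y] green_ground[OF ground])
  qed
  also have "4 * (interp G L ?\<gamma> y - interp G L (spread y) y) = (\<Sum>e\<in>arcs G. kink_term y e)"
  proof (cases y)
    case (Vertex v)
    then show ?thesis by (simp add: spread_def kink_term_def)
  next
    case (Interior e s)
    then have e: "e \<in> arcs G" using y by simp
    have "(\<Sum>k\<in>arcs G. kink_term y k)
        = (\<Sum>k\<in>arcs G. if k = e then 4 * (s / L e) * (1 - s / L e) * edge_res e else 0)"
      by (intro sum.cong refl) (auto simp: kink_term_def Interior)
    also have "\<dots> = 4 * (s / L e) * (1 - s / L e) * edge_res e"
      using e by simp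
    finally have kink: "(\<Sum>k\<in>arcs G. kink_term y k) = \<dots>" .
    show ?thesis
      unfolding kink using length_pos[OF e]
      by (simp add: Interior spread_def edge_res_eq[OF e] green_sym[of "head G e" "tail G e"] e field_simps)
  qed
  finally show ?thesis by simp
qed

text \<open>\<open>d\<close> is the voltage grounded at \<open>p\<close> up to a constant, and
  \<open>J\<close> gives the values of the other voltage at the vertices. Along an edge the former
  is affine and the latter is affine plus a multiple of the bump, so
  \<open>has_integral_bump\<close> applies.\<close>

lemma A_const_eq:
  assumes p: "p \<in> verts G" and q: "q \<in> verts G"
  defines "d \<equiv> \<lambda>u. g q u - g p u" and "J \<equiv> \<lambda>x. g p q - g p x - g x q + g x x"
  shows "A_const G L (Vertex p) (Vertex q) = (\<Sum>k\<in>arcs G. (arc_diff G d k)\<^sup>2 / L k *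
    ((J (tail G k) + J (head G k)) / 2 + (L k - edge_res k) / 6))"
  unfolding A_const_def graph_integral_def
proof (intro sum.cong refl)
  fix k assume k: "k \<in> arcs G"
  have L: "0 < L k" by (rule length_pos[OF k])
  have spread: "spread (Vertex v) u = g v u" if "v \<in> verts G" "u \<in> verts G" for u v
    using that by (simp add: spread_def green_sym)
  have kernel: "green_kernel (edge_point G L k t) (Vertex v) = g v (tail G k) + arc_diff G (g v) k / L k * t"
    if "v \<in> verts G" "0 < t" "t < L k" for v t
    using that k by (simp add: kernel_edge_point spread hat_def)
  have deriv: "arc_deriv G L (\<lambda>w. voltage G L (Vertex p) w (Vertex q)) (edge_point G L k t) = arc_diff G d k / L k"
    if t: "0 < t" "t < L k" for t
  proof (rule arc_deriv_edge_point[where L = L and e = k, OF t])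
    let ?v = "\<lambda>t. (d (tail G k) - (g p q - g p p)) + arc_diff G d k / L k * t"
    show "(?v has_real_derivative arc_diff G d k / L k) (at t)"
      using L by (auto intro!: derivative_eq_intros)
    fix t assume "0 < t" "t < L k"
    then show "voltage G L (Vertex p) (edge_point G L k t) (Vertex q) = ?v t"
      using k p q by (simp add: voltage_eq_kernel kernel green_kernel_vertex d_def
          algebra_simps diff_divide_distrib add_divide_distrib)
  qed
  have voltage: "voltage G L (edge_point G L k t) (Vertex p) (Vertex q)
      = J (tail G k) + arc_diff G J k / L k * t + (1 - edge_res k / L k) * (t - t\<^sup>2 / L k)"
    if t: "0 < t" "t < L k" for t
  proof -
    have "voltage G L (edge_point G L k t) (Vertex p) (Vertex q)
        = g p q - green_kernel (edge_point G L k t) (Vertex p) - green_kernel (edge_point G L k t) (Vertex q)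
          + green_kernel (edge_point G L k t) (edge_point G L k t)"
      using k p q by (simp add: voltage_eq_kernel green_kernel_vertex green_kernel_commute[of "Vertex p"])
    also have "\<dots> = J (tail G k) + arc_diff G J k / L k * t + (1 - edge_res k / L k) * (t - t\<^sup>2 / L k)"
      unfolding kernel[OF p t] kernel[OF q t] green_kernel_diagonal[OF k t]
      using k q by (simp add: J_def green_sym[of _ q] algebra_simps diff_divide_distrib add_divide_distrib)
    finally show ?thesis .
  qed
  have "((\<lambda>t. (J (tail G k) + arc_diff G J k / L k * t + (1 - edge_res k / L k) * (t - t\<^sup>2 / L k))
      * (arc_diff G d k / L k)\<^sup>2) has_integral
      (J (tail G k) * L k + arc_diff G J k / L k * (L k)\<^sup>2 / 2 + (1 - edge_res k / L k) * (L k)\<^sup>2 / 6)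
      * (arc_diff G d k / L k)\<^sup>2) {0..L k}"
    by (intro has_integral_mult_left has_integral_bump L)
  then have "((\<lambda>t. voltage G L (edge_point G L k t) (Vertex p) (Vertex q)
      * (arc_deriv G L (\<lambda>w. voltage G L (Vertex p) w (Vertex q)) (edge_point G L k t))\<^sup>2) has_integral
      (J (tail G k) * L k + arc_diff G J k / L k * (L k)\<^sup>2 / 2 + (1 - edge_res k / L k) * (L k)\<^sup>2 / 6)
      * (arc_diff G d k / L k)\<^sup>2) {0..L k}"
    by (rule has_integral_spike_finite[of "{0, L k}", rotated 2]) (auto simp: deriv voltage)
  then have "integral {0..L k} (\<lambda>t. voltage G L (edge_point G L k t) (Vertex p) (Vertex q)
      * (arc_deriv G L (\<lambda>w. voltage G L (Vertex p) w (Vertex q)) (edge_point G L k t))\<^sup>2)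
      = (J (tail G k) * L k + arc_diff G J k / L k * (L k)\<^sup>2 / 2 + (1 - edge_res k / L k) * (L k)\<^sup>2 / 6)
      * (arc_diff G d k / L k)\<^sup>2"
    by (rule integral_unique)
  also have "J (tail G k) * L k + arc_diff G J k / L k * (L k)\<^sup>2 / 2 + (1 - edge_res k / L k) * (L k)\<^sup>2 / 6
      = L k * ((J (tail G k) + J (head G k)) / 2 + (L k - edge_res k) / 6)"
    using L by (simp add: power2_eq_square field_simps)
  also have "\<dots> * (arc_diff G d k / L k)\<^sup>2 = (arc_diff G d k)\<^sup>2 / L k *
      ((J (tail G k) + J (head G k)) / 2 + (L k - edge_res k) / 6)"
    using L by (simp add: power2_eq_square)
  finally show "integral {0..L k} (\<lambda>t. voltage G L (edge_point G L k t) (Vertex p) (Vertex q)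
      * (arc_deriv G L (\<lambda>w. voltage G L (Vertex p) w (Vertex q)) (edge_point G L k t))\<^sup>2)
      = (arc_diff G d k)\<^sup>2 / L k * ((J (tail G k) + J (head G k)) / 2 + (L k - edge_res k) / 6)" .
qed

text \<open>With \<open>D = L e - edge_res e\<close>, the perturbed Green function scales the drops
  of the dipole by \<open>L e / D\<close>, and the denominator's base is
  \<open>(L e)\<^sup>2 / D\<close>. All powers of \<open>D\<close> outside
  \<open>deletion_sum e\<close> cancel.\<close>

lemma A_const_del_arc:
  assumes e: "e \<in> arcs G" and H: "metrized_graph (del_arc e) L"
  shows "L e * A_const (del_arc e) L (Vertex (tail G e)) (Vertex (head G e))
      / (L e + eff_resistance (del_arc e) L (Vertex (tail G e)) (Vertex (head G e)))\<^sup>2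
    = deletion_sum e / L e"
proof -
  let ?p = "tail G e" and ?q = "head G e"
  define D where "D = L e - edge_res e"
  define s where "s = dipole e"
  have pos: "0 < L e" "0 < D" and D: "edge_res e = L e - D"
    using length_pos[OF e] edge_res_less[OF e H] by (auto simp: D_def)
  interpret H: grounded_graph "del_arc e" L ground "\<lambda>a b. g a b + s a * s b / D"
    unfolding s_def D_def by (rule grounded_graph_del_arc[OF e H])
  have pq: "?p \<in> verts (del_arc e)" "?q \<in> verts (del_arc e)"
    using e by auto
  have s: "s ?q - s ?p = L e - D"
    using D by (simp add: s_def edge_res_def)
  have R: "eff_resistance (del_arc e) L (Vertex ?p) (Vertex ?q) = (L e - D) * L e / D"
  proof -
    have "eff_resistance (del_arc e) L (Vertex ?p) (Vertex ?q) = edge_res e + (s ?q - s ?p)\<^sup>2 / D"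
      using pq pos unfolding H.eff_resistance_eq_green_kernel[OF H.vertex_in_points[OF pq(1)] H.vertex_in_points[OF pq(2)]]
        H.green_kernel_vertex edge_res_eq[OF e]
      by (simp add: field_simps power2_eq_square)
    also have "\<dots> = (L e - D) * L e / D"
      unfolding s D using pos by (simp add: field_simps power2_eq_square)
    finally show ?thesis .
  qed
  have res: "H.edge_res k = edge_res k + (arc_diff G s k)\<^sup>2 / D" if k: "k \<in> arcs G - {e}" for k
  proof -
    have k': "k \<in> arcs G" "k \<in> arcs (del_arc e)" using k by simp_all
    show ?thesis
      unfolding H.edge_res_eq[OF k'(2)] edge_res_eq[OF k'(1)]
      using pos by (simp add: field_simps power2_eq_square)
  qed
  have slope: "g ?q u + s ?q * s u / D - (g ?p u + s ?p * s u / D) = L e / D * s u" for u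
  proof -
    have "g ?q u + s ?q * s u / D - (g ?p u + s ?p * s u / D) = s u + (s ?q - s ?p) * s u / D"
      by (simp add: s_def dipole_def left_diff_distrib diff_divide_distrib)
    also have "\<dots> = L e / D * s u"
      unfolding s using pos by (simp add: field_simps)
    finally show ?thesis .
  qed
  have leg: "g ?p ?q + s ?p * s ?q / D - (g ?p x + s ?p * s x / D) - (g x ?q + s x * s ?q / D) + (g x x + s x * s x / D)
      = star_leg e x + (s x - s ?p) * (s x - s ?q) / D" for x
    using pos by (simp add: star_leg_def field_simps)
  have "A_const (del_arc e) L (Vertex ?p) (Vertex ?q) = (\<Sum>k\<in>arcs G - {e}.
      (L e / D * arc_diff G s k)\<^sup>2 / L k *
      ((star_leg e (tail G k) + (s (tail G k) - s ?p) * (s (tail G k) - s ?q) / D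
        + (star_leg e (head G k) + (s (head G k) - s ?p) * (s (head G k) - s ?q) / D)) / 2
        + (L k - (edge_res k + (arc_diff G s k)\<^sup>2 / D)) / 6))"
    unfolding H.A_const_eq[OF pq] slope leg arcs_del_arc head_del_arc tail_del_arc
    by (intro sum.cong refl) (simp add: res right_diff_distrib)
  also have "\<dots> = (L e / D)\<^sup>2 * deletion_sum e"
  proof -
    have "(c * a)\<^sup>2 / l * ((i + u / D + (j + v / D)) / 2 + (l - (r + a\<^sup>2 / D)) / 6)
        = c\<^sup>2 * (a\<^sup>2 / l * ((i + j) / 2 + (l - r) / 6 + (u / 2 + v / 2 - a\<^sup>2 / 6) / D))"
      for a c i j l r u v :: real
    proof -
      have "(i + u / D + (j + v / D)) / 2 + (l - (r + a\<^sup>2 / D)) / 6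
          = (i + j) / 2 + (l - r) / 6 + (u / 2 + v / 2 - a\<^sup>2 / 6) / D"
        using pos by (simp add: field_simps)
      then show ?thesis by (simp add: power_mult_distrib)
    qed
    then show ?thesis
      unfolding deletion_sum_def s_def [symmetric] D_def [symmetric] sum_distrib_left
      by (intro sum.cong refl)
  qed
  finally have A: "A_const (del_arc e) L (Vertex ?p) (Vertex ?q) = (L e / D)\<^sup>2 * deletion_sum e" .
  have "L e + (L e - D) * L e / D = L e * (L e / D)"
    using pos by (simp add: field_simps)
  then show ?thesis
    unfolding A R using pos by (simp add: power2_eq_square field_simps)
qed

end

theorem theorem5p7:
  fixes G :: "('v, 'e) pre_digraph" and L :: "'e \<Rightarrow> real" and y :: "('v, 'e) point"
  assumes "metrized_graph G L"
    and "bridgeless G"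
    and "y \<in> points G L"
  shows "tau G L y = total_length G L / 12
    - (\<Sum>e \<in> arcs G.
        L e * A_const (pre_digraph.del_arc G e) L (Vertex (tail G e)) (Vertex (head G e))
        / (L e + eff_resistance (pre_digraph.del_arc G e) L
                   (Vertex (tail G e)) (Vertex (head G e)))\<^sup>2)"
proof -
  interpret metrized_graph G L by (rule assms(1))
  obtain ground g where "grounded_graph G L ground g"
    using grounded_graph_exists by blast
  then interpret grounded_graph G L ground g .
  \<comment> \<open>Bridgelessness enters here: it keeps each deleted graph connected, hence
    \<open>edge_res e < L e\<close> and the perturbation formula is available.\<close>
  have H: "metrized_graph (del_arc e) L" if "e \<in> arcs G" for e
  proof -
    interpret H: fin_digraph "del_arc e" by (rule fin_digraph_del_arc)
    show ?thesis
      by unfold_locales (use that assms(2) in \<open>auto simp: bridgeless_def length_pos\<close>)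
  qed
  have "4 * tau G L y = 4 * (total_length G L / 12 - (\<Sum>e\<in>arcs G. deletion_sum e / L e))"
    unfolding tau_eq[OF assms(3)] by (rule sum_deletion_sum) (rule edge_res_less[OF _ H])
  then show ?thesis
    by (simp add: A_const_del_arc H)
qed

end
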